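(* Let $\mathbb K$ be a field. The primitive operad $\mathrm{Prim}_{As}Dup$ of the bialgebra type $As^c\text{-}Dup$ is the magmatic operad $Mag$, and the corresponding functor $$F:Dup\text{-alg}\to Mag\text{-alg},\qquad F(A,\prec,\succ)=(A,\cdot),$$ is determined by $$x\cdot y:=x\prec y-x\succ y .$$
   Context: A duplicial algebra ($Dup$-algebra) is a $\mathbb K$-vector space with two binary operations $\prec,\succ$ satisfying $(x\prec y)\prec z=x\prec(y\prec z)$, $(x\succ y)\prec z=x\succ(y\prec z)$, $(x\succ y)\succ z=x\succ(y\succ z)$. $Dup$ is the corresponding operad and $Dup(V)$ the free duplicial algebra. A magmatic algebra is a vector space with one binary operation subject to no relation; $Mag$ is its operad, i.e. the free operad on one binary operation without symmetry. An $As^c\text{-}Dup$-bialgebra is a duplicial algebra $\mathcal H$ with a coassociative linear map $\delta:\mathcal H\to\mathcal H\otimes\mathcal H$, $\delta(x)=x_{(1)}\otimes x_{(2)}$ (summation understood), such that for $\circ={\prec}$ and $\circ={\succ}$: $\delta(x\circ y)=x\otimes y+x_{(1)}\otimes(x_{(2)}\circ y)+(x\circ y_{(1)})\otimes y_{(2)}$. The free duplicial algebra $Dup(V)$ has a functorial such bialgebra structure with $\delta(V)=0$. An element $x$ is primitive if $\delta(x)=0$. $\mathrm{Prim}_{As}Dup$ is the suboperad of $Dup$ whose arity-$n$ part consists of the operations $\mu\in Dup(n)$ such that $\mu(x_1,\dots,x_n)$ is a primitive element of $Dup(\mathbb Kx_1\oplus\cdots\oplus\mathbb Kx_n)$. The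 functor $F$ is the forgetful functor from $Dup$-algebras to $\mathrm{Prim}_{As}Dup$-algebras given by restriction along the inclusion $\mathrm{Prim}_{As}Dup\subset Dup$. So the theorem says that $\mathrm{Prim}_{As}Dup$ is freely generated, as an operad, by the binary operation $x\prec y-x\succ y$. *)

theory Defs
  imports "HOL-Library.Poly_Mapping" "HOL-Combinatorics.Permutations" HOL.Vector_Spaces
begin

section \<open>Free vector spaces\<close>

text \<open>The vector space with basis \<^typ>\<open>'b\<close> over the field \<^typ>\<open>'k\<close> is the type of finitely
  supported functions \<^typ>\<open>'b \<Rightarrow>\<^sub>0 'k\<close>.\<close>

definition fscale :: "'k::field \<Rightarrow> ('b \<Rightarrow>\<^sub>0 'k) \<Rightarrow> ('b \<Rightarrow>\<^sub>0 'k)" where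
  "fscale c p = Poly_Mapping.map ((*) c) p"

definition basis :: "'b \<Rightarrow> ('b \<Rightarrow>\<^sub>0 'k::field)" where
  "basis b = Poly_Mapping.single b 1"

definition lin_ext :: "('k::field \<Rightarrow> 'a \<Rightarrow> 'a::ab_group_add) \<Rightarrow> ('b \<Rightarrow> 'a) \<Rightarrow> ('b \<Rightarrow>\<^sub>0 'k) \<Rightarrow> 'a" where
  "lin_ext s f p = (\<Sum>b\<in>Poly_Mapping.keys p. s (Poly_Mapping.lookup p b) (f b))"

lemma lookup_fscale [simp]: "Poly_Mapping.lookup (fscale c p) b = c * Poly_Mapping.lookup p b"
  by (auto simp: fscale_def Poly_Mapping.map.rep_eq when_def)

interpretation fvs: vector_space "fscale :: 'k::field \<Rightarrow> ('b \<Rightarrow>\<^sub>0 'k) \<Rightarrow> ('b \<Rightarrow>\<^sub>0 'k)"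
  by standard (auto intro!: poly_mapping_eqI simp: lookup_add algebra_simps)

lemma fscale_single: "fscale c (Poly_Mapping.single b d) = Poly_Mapping.single b (c * d)"
  by (rule poly_mapping_eqI) (simp add: lookup_single when_def)

lemma single_fscale_basis: "Poly_Mapping.single b c = fscale c (basis b)"
  by (simp add: basis_def fscale_single)

lemma lin_ext_superset:
  assumes "vector_space s" "finite A" "Poly_Mapping.keys p \<subseteq> A"
  shows "lin_ext s f p = (\<Sum>b\<in>A. s (Poly_Mapping.lookup p b) (f b))"
proof -
  interpret vector_space s by fact
  show ?thesis unfolding lin_ext_def
    by (rule sum.mono_neutral_left) (use assms in \<open>auto simp: in_keys_iff\<close>)
qed

lemma lin_ext_add:
  assumes "vector_space s"
  shows "lin_ext s f (p + q) = lin_ext s f p + lin_ext s f q"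
proof -
  interpret vector_space s by fact
  let ?A = "Poly_Mapping.keys p \<union> Poly_Mapping.keys q"
  have "lin_ext s f (p + q) = (\<Sum>b\<in>?A. s (Poly_Mapping.lookup (p + q) b) (f b))"
    by (rule lin_ext_superset) (use assms keys_add[of p q] in auto)
  moreover have "lin_ext s f p = (\<Sum>b\<in>?A. s (Poly_Mapping.lookup p b) (f b))"
    "lin_ext s f q = (\<Sum>b\<in>?A. s (Poly_Mapping.lookup q b) (f b))"
    by (rule lin_ext_superset; use assms in auto)+
  ultimately show ?thesis by (simp add: lookup_add scale_left_distrib sum.distrib)
qed

lemma lin_ext_scale:
  assumes "vector_space s"
  shows "lin_ext s f (fscale c p) = s c (lin_ext s f p)"
proof -
  interpret vector_space s by fact
  have "lin_ext s f (fscale c p)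
      = (\<Sum>b\<in>Poly_Mapping.keys p. s (Poly_Mapping.lookup (fscale c p) b) (f b))"
    by (rule lin_ext_superset) (use assms in \<open>auto simp: in_keys_iff\<close>)
  then show ?thesis by (simp add: lin_ext_def scale_sum_right)
qed

lemma lin_ext_single:
  assumes "vector_space s"
  shows "lin_ext s f (Poly_Mapping.single b c) = s c (f b)"
proof -
  interpret vector_space s by fact
  show ?thesis by (simp add: lin_ext_def)
qed

lemma lin_ext_basis:
  assumes "vector_space s"
  shows "lin_ext s f (basis b) = f b"
proof -
  interpret vector_space s by fact
  show ?thesis by (simp add: basis_def lin_ext_single assms)
qed

lemma linear_lin_ext:
  assumes "vector_space s"
  shows "Vector_Spaces.linear fscale s (lin_ext s f)"
proof -
  interpret vector_space s by fact
  show ?thesis by unfold_locales (auto simp: lin_ext_add lin_ext_scale assms)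
qed

lemma free_induct [case_names zero add scale basis]:
  fixes p :: "'b \<Rightarrow>\<^sub>0 'k::field"
  assumes "P 0" "\<And>p q. P p \<Longrightarrow> P q \<Longrightarrow> P (p + q)" "\<And>c p. P p \<Longrightarrow> P (fscale c p)" "\<And>b. P (basis b)"
  shows "P p"
proof -
  have "p = lin_ext fscale basis p"
    by (rule poly_mapping_eqI)
      (auto simp: lin_ext_def lookup_sum basis_def lookup_single when_def in_keys_iff
        if_distrib[of "\<lambda>x. _ * x"] cong: if_cong)
  moreover have "P (\<Sum>b\<in>A. fscale (Poly_Mapping.lookup p b) (basis b))" if "finite A" for A
    using that by induction (auto intro: assms)
  ultimately show ?thesis unfolding lin_ext_def by (metis finite_keys)
qed


section \<open>Magmatic algebras\<close>

datatype ('o, 'v) bintree = Leaf 'v | Node 'o "('o, 'v) bintree" "('o, 'v) bintree"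

primrec tree_eval :: "('o \<Rightarrow> 'a \<Rightarrow> 'a \<Rightarrow> 'a) \<Rightarrow> ('v \<Rightarrow> 'a) \<Rightarrow> ('o, 'v) bintree \<Rightarrow> 'a" where
  "tree_eval m f (Leaf v) = f v"
| "tree_eval m f (Node b s t) = m b (tree_eval m f s) (tree_eval m f t)"

primrec leaves :: "('o, 'v) bintree \<Rightarrow> 'v list" where
  "leaves (Leaf v) = [v]"
| "leaves (Node b s t) = leaves s @ leaves t"

text \<open>The space \<^typ>\<open>('o, 'v) bintree \<Rightarrow>\<^sub>0 'k\<close> with the bilinear extensions of the grafting
  operations is the free algebra on \<^typ>\<open>'v\<close> with one binary operation for each element of
  \<^typ>\<open>'o\<close> and no relations.\<close>

definition graft :: "'o \<Rightarrow> (('o, 'v) bintree \<Rightarrow>\<^sub>0 'k) \<Rightarrow> (('o, 'v) bintree \<Rightarrow>\<^sub>0 'k)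
    \<Rightarrow> (('o, 'v) bintree \<Rightarrow>\<^sub>0 'k::field)" where
  "graft b p q = lin_ext fscale (\<lambda>s. lin_ext fscale (\<lambda>t. basis (Node b s t)) q) p"

locale mag_algebra = vector_space scale
  for scale :: "'k::field \<Rightarrow> 'a \<Rightarrow> 'a::ab_group_add" +
  fixes mul :: "'a \<Rightarrow> 'a \<Rightarrow> 'a"
  assumes mul_add_left: "mul (x + y) z = mul x z + mul y z"
    and mul_add_right: "mul x (y + z) = mul x y + mul x z"
    and mul_scale_left: "mul (scale c x) y = scale c (mul x y)"
    and mul_scale_right: "mul x (scale c y) = scale c (mul x y)"
begin

lemma mul_zero_left [simp]: "mul 0 y = 0"
  using mul_scale_left[of 0 0 y] by simp

lemma mul_zero_right [simp]: "mul x 0 = 0"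
  using mul_scale_right[of x 0 0] by simp

lemma mul_diff_left: "mul (x - y) z = mul x z - mul y z"
  using mul_add_left[of "x - y" y z] by simp

lemma mul_diff_right: "mul x (y - z) = mul x y - mul x z"
  using mul_add_right[of x "y - z" z] by simp

end

lemma graft_add_left: "graft b (p + p') q = graft b p q + graft b p' q"
  by (simp add: graft_def lin_ext_add fvs.vector_space_axioms)

lemma graft_scale_left: "graft b (fscale c p) q = fscale c (graft b p q)"
  by (simp add: graft_def lin_ext_scale fvs.vector_space_axioms)

lemma graft_basis: "graft b (basis s) (basis t) = basis (Node b s t)"
  by (simp add: graft_def lin_ext_basis fvs.vector_space_axioms)

lemma graft_add_right: "graft b p (q + q') = graft b p q + graft b p q'"
  by (induction p rule: free_induct)
    (simp_all add: graft_add_left graft_scale_left fvs.scale_right_distrib algebra_simps,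
     simp_all add: graft_def lin_ext_basis lin_ext_add lin_ext_scale fvs.vector_space_axioms,
     simp add: lin_ext_def)

lemma graft_scale_right: "graft b p (fscale c q) = fscale c (graft b p q)"
  by (induction p rule: free_induct)
    (simp_all add: graft_add_left graft_scale_left fvs.scale_right_distrib mult.commute,
     simp_all add: graft_def lin_ext_basis lin_ext_add lin_ext_scale fvs.vector_space_axioms,
     simp add: lin_ext_def)

interpretation graft: mag_algebra fscale "graft b"
  by standard (simp_all add: graft_add_left graft_add_right graft_scale_left graft_scale_right)

definition free_ext :: "('k::field \<Rightarrow> 'a \<Rightarrow> 'a::ab_group_add) \<Rightarrow> ('o \<Rightarrow> 'a \<Rightarrow> 'a \<Rightarrow> 'a) \<Rightarrow> ('v \<Rightarrow> 'a)
    \<Rightarrow> (('o, 'v) bintree \<Rightarrow>\<^sub>0 'k) \<Rightarrow> 'a" where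
  "free_ext scale m f = lin_ext scale (tree_eval m f)"

lemma free_ext_graft:
  assumes "\<And>b. mag_algebra scale (m b)"
  shows "free_ext scale m f (graft b p q) = m b (free_ext scale m f p) (free_ext scale m f q)"
proof -
  interpret mag_algebra scale "m b" by fact
  note [simp] = free_ext_def lin_ext_basis lin_ext_add lin_ext_scale vector_space_axioms
    mul_add_left mul_add_right mul_scale_left mul_scale_right
    graft_add_left graft_add_right graft_scale_left graft_scale_right
  have z: "lin_ext scale g 0 = 0" for g by (simp add: lin_ext_def)
  show ?thesis
  proof (induction p rule: free_induct)
    case (basis s)
    show ?case
      by (induction q rule: free_induct) (simp_all add: graft_basis z mul_zero_right)
  qed (simp_all add: z mul_zero_left)
qed

type_synonym ('v, 'k) mag = "(unit, 'v) bintree \<Rightarrow>\<^sub>0 'k"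

abbreviation mag_mult :: "('v, 'k) mag \<Rightarrow> ('v, 'k) mag \<Rightarrow> ('v, 'k::field) mag" where
  "mag_mult \<equiv> graft ()"

definition mag_gen :: "'v \<Rightarrow> ('v, 'k::field) mag" where
  "mag_gen v = basis (Leaf v)"

definition mag_ext :: "('k::field \<Rightarrow> 'a \<Rightarrow> 'a::ab_group_add) \<Rightarrow> ('a \<Rightarrow> 'a \<Rightarrow> 'a) \<Rightarrow> ('v \<Rightarrow> 'a)
    \<Rightarrow> ('v, 'k) mag \<Rightarrow> 'a" where
  "mag_ext scale mul = free_ext scale (\<lambda>_. mul)"


section \<open>Duplicial algebras\<close>

locale dup_algebra = prec: mag_algebra scale prec + succ: mag_algebra scale succ
  for scale :: "'k::field \<Rightarrow> 'a \<Rightarrow> 'a::ab_group_add"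
    and prec :: "'a \<Rightarrow> 'a \<Rightarrow> 'a" and succ :: "'a \<Rightarrow> 'a \<Rightarrow> 'a" +
  assumes prec_prec: "prec (prec x y) z = prec x (prec y z)"
    and succ_prec: "prec (succ x y) z = succ x (prec y z)"
    and succ_succ: "succ (succ x y) z = succ x (succ y z)"

datatype dup_op = Prec | Succ

text \<open>The free duplicial algebra on \<^typ>\<open>'v\<close>, i.e. \<open>Dup(V)\<close> for \<open>V\<close> with basis \<^typ>\<open>'v\<close>, is the
  quotient of the free algebra with two binary operations by the two-sided ideal generated by
  the duplicial relations.\<close>

inductive_set dup_ideal :: "((dup_op, 'v) bintree \<Rightarrow>\<^sub>0 'k::field) set" where
  zero: "0 \<in> dup_ideal"
| add: "p \<in> dup_ideal \<Longrightarrow> q \<in> dup_ideal \<Longrightarrow> p + q \<in> dup_ideal"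
| scale: "p \<in> dup_ideal \<Longrightarrow> fscale c p \<in> dup_ideal"
| left: "p \<in> dup_ideal \<Longrightarrow> graft b p q \<in> dup_ideal"
| right: "p \<in> dup_ideal \<Longrightarrow> graft b q p \<in> dup_ideal"
| prec_prec: "graft Prec (graft Prec p q) r - graft Prec p (graft Prec q r) \<in> dup_ideal"
| succ_prec: "graft Prec (graft Succ p q) r - graft Succ p (graft Prec q r) \<in> dup_ideal"
| succ_succ: "graft Succ (graft Succ p q) r - graft Succ p (graft Succ q r) \<in> dup_ideal"

lemma dup_ideal_uminus: "p \<in> dup_ideal \<Longrightarrow> - p \<in> dup_ideal"
  using dup_ideal.scale[of p "- 1"] by simp

lemma dup_ideal_diff: "p \<in> dup_ideal \<Longrightarrow> q \<in> dup_ideal \<Longrightarrow> p - q \<in> dup_ideal"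
  using dup_ideal.add[of p "- q"] dup_ideal_uminus[of q] by simp

quotient_type (overloaded) ('v, 'k) dup = "(dup_op, 'v) bintree \<Rightarrow>\<^sub>0 'k::field"
  / "\<lambda>p q. p - q \<in> dup_ideal"
proof (rule equivpI)
  show "reflp (\<lambda>p q :: (dup_op, 'v) bintree \<Rightarrow>\<^sub>0 'k. p - q \<in> dup_ideal)"
    by (auto intro!: reflpI dup_ideal.zero)
  show "symp (\<lambda>p q :: (dup_op, 'v) bintree \<Rightarrow>\<^sub>0 'k. p - q \<in> dup_ideal)"
    using dup_ideal_uminus by (fastforce intro!: sympI)
  show "transp (\<lambda>p q :: (dup_op, 'v) bintree \<Rightarrow>\<^sub>0 'k. p - q \<in> dup_ideal)"
    using dup_ideal.add by (fastforce intro!: transpI)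
qed

instantiation dup :: (type, field) ab_group_add
begin

lift_definition zero_dup :: "('a, 'b) dup" is 0 .

lift_definition plus_dup :: "('a, 'b) dup \<Rightarrow> ('a, 'b) dup \<Rightarrow> ('a, 'b) dup" is "(+)"
proof -
  fix p p' q q' :: "(dup_op, 'a) bintree \<Rightarrow>\<^sub>0 'b"
  assume "p - p' \<in> dup_ideal" "q - q' \<in> dup_ideal"
  then have "(p - p') + (q - q') \<in> dup_ideal" by (rule dup_ideal.add)
  then show "(p + q) - (p' + q') \<in> dup_ideal" by (simp add: algebra_simps)
qed

lift_definition uminus_dup :: "('a, 'b) dup \<Rightarrow> ('a, 'b) dup" is uminus
proof -
  fix p p' :: "(dup_op, 'a) bintree \<Rightarrow>\<^sub>0 'b"
  assume "p - p' \<in> dup_ideal"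
  then have "- (p - p') \<in> dup_ideal" by (rule dup_ideal_uminus)
  then show "- p - (- p') \<in> dup_ideal" by simp
qed

lift_definition minus_dup :: "('a, 'b) dup \<Rightarrow> ('a, 'b) dup \<Rightarrow> ('a, 'b) dup" is "(-)"
proof -
  fix p p' q q' :: "(dup_op, 'a) bintree \<Rightarrow>\<^sub>0 'b"
  assume "p - p' \<in> dup_ideal" "q - q' \<in> dup_ideal"
  then have "(p - p') - (q - q') \<in> dup_ideal" by (rule dup_ideal_diff)
  then show "(p - q) - (p' - q') \<in> dup_ideal" by (simp add: algebra_simps)
qed

instance
  by standard (transfer, simp add: dup_ideal.zero algebra_simps)+

end

lift_definition dup_scale :: "'k::field \<Rightarrow> ('v, 'k) dup \<Rightarrow> ('v, 'k) dup" is fscale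
  by (simp add: dup_ideal.scale flip: fvs.scale_right_diff_distrib)

lift_definition dup_mult :: "dup_op \<Rightarrow> ('v, 'k) dup \<Rightarrow> ('v, 'k) dup \<Rightarrow> ('v, 'k::field) dup" is graft
proof -
  fix b and p p' q q' :: "(dup_op, 'v) bintree \<Rightarrow>\<^sub>0 'k"
  assume "p - p' \<in> dup_ideal" "q - q' \<in> dup_ideal"
  then have "graft b (p - p') q + graft b p' (q - q') \<in> dup_ideal"
    by (intro dup_ideal.intros)
  then show "graft b p q - graft b p' q' \<in> dup_ideal"
    by (simp add: graft.mul_diff_left graft.mul_diff_right)
qed

lift_definition dup_gen :: "'v \<Rightarrow> ('v, 'k::field) dup" is "\<lambda>v. basis (Leaf v)" .

abbreviation dup_prec :: "('v, 'k) dup \<Rightarrow> ('v, 'k) dup \<Rightarrow> ('v, 'k::field) dup" where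
  "dup_prec \<equiv> dup_mult Prec"

abbreviation dup_succ :: "('v, 'k) dup \<Rightarrow> ('v, 'k) dup \<Rightarrow> ('v, 'k::field) dup" where
  "dup_succ \<equiv> dup_mult Succ"

interpretation dup: vector_space "dup_scale :: 'k::field \<Rightarrow> ('v, 'k) dup \<Rightarrow> ('v, 'k) dup"
  by standard
    (transfer, simp add: fvs.scale_right_distrib fvs.scale_left_distrib dup_ideal.zero)+

interpretation dup: mag_algebra dup_scale "dup_mult b"
  by standard
    (transfer, simp add: graft_add_left graft_add_right graft_scale_left graft_scale_right
      dup_ideal.zero)+

interpretation dup: dup_algebra dup_scale dup_prec dup_succ
  by standard (transfer, rule dup_ideal.intros)+

text \<open>The algebra morphism extending a map on generators is computed on a representative;
  \<open>dup_ext_abs\<close> below shows that the choice is irrelevant.\<close>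

definition dup_ext :: "('k::field \<Rightarrow> 'a \<Rightarrow> 'a::ab_group_add) \<Rightarrow> ('a \<Rightarrow> 'a \<Rightarrow> 'a) \<Rightarrow> ('a \<Rightarrow> 'a \<Rightarrow> 'a)
    \<Rightarrow> ('v \<Rightarrow> 'a) \<Rightarrow> ('v, 'k) dup \<Rightarrow> 'a" where
  "dup_ext scale prec succ f x =
     free_ext scale (\<lambda>b. case b of Prec \<Rightarrow> prec | Succ \<Rightarrow> succ) f (rep_dup x)"

lemmas abs_rep_dup = Quotient3_abs_rep[OF Quotient3_dup]

lemma rep_abs_dup: "rep_dup (abs_dup p) - p \<in> dup_ideal"
  using Quotient3_rep_abs[OF Quotient3_dup, of p] by (simp add: dup_ideal.zero)

context dup_algebra
begin

lemma dup_ext_abs: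
  "dup_ext scale prec succ f (abs_dup p) =
     free_ext scale (\<lambda>b. case b of Prec \<Rightarrow> prec | Succ \<Rightarrow> succ) f p"
proof -
  let ?e = "free_ext scale (\<lambda>b. case b of Prec \<Rightarrow> prec | Succ \<Rightarrow> succ) f"
  interpret l: Vector_Spaces.linear fscale scale ?e
    unfolding free_ext_def by (rule linear_lin_ext) (rule prec.vector_space_axioms)
  have m: "?e (graft b q r) = (case b of Prec \<Rightarrow> prec | Succ \<Rightarrow> succ) (?e q) (?e r)" for b q r
    by (rule free_ext_graft)
      (auto split: dup_op.split intro: prec.mag_algebra_axioms succ.mag_algebra_axioms)
  have "?e q = 0" if "q \<in> dup_ideal" for q
    using that
    by induction (auto simp: m l.add l.scale l.diff prec_prec succ_prec succ_succ
        split: dup_op.split)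
  from this[OF rep_abs_dup] show ?thesis
    by (simp add: dup_ext_def l.diff)
qed

end


section \<open>The bialgebra structure on the free duplicial algebra\<close>

text \<open>The tensor square of the vector space \<open>Dup(V)\<close>.\<close>

definition bilinear_relations :: "('k::field \<Rightarrow> 'a \<Rightarrow> 'a::ab_group_add)
    \<Rightarrow> ('k \<Rightarrow> 'b \<Rightarrow> 'b::ab_group_add) \<Rightarrow> ('a \<times> 'b \<Rightarrow>\<^sub>0 'k) set" where
  "bilinear_relations s s' =
     {basis (x + x', y) - basis (x, y) - basis (x', y) | x x' y. True} \<union>
     {basis (x, y + y') - basis (x, y) - basis (x, y') | x y y'. True} \<union>
     {basis (s c x, y) - fscale c (basis (x, y)) | c x y. True} \<union>
     {basis (x, s' c y) - fscale c (basis (x, y)) | c x y. True}"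

quotient_type (overloaded) ('v, 'k) dup_tensor = "('v, 'k) dup \<times> ('v, 'k) dup \<Rightarrow>\<^sub>0 'k::field"
  / "\<lambda>p q. p - q \<in> fvs.span (bilinear_relations dup_scale dup_scale)"
proof (rule equivpI)
  let ?R = "\<lambda>p q :: ('v, 'k) dup \<times> ('v, 'k) dup \<Rightarrow>\<^sub>0 'k.
    p - q \<in> fvs.span (bilinear_relations dup_scale dup_scale)"
  show "reflp ?R"
    by (auto intro!: reflpI fvs.span_zero)
  show "symp ?R"
    using fvs.span_neg by (fastforce intro!: sympI)
  show "transp ?R"
    using fvs.span_add by (fastforce intro!: transpI)
qed

instantiation dup_tensor :: (type, field) ab_group_add
begin

lift_definition zero_dup_tensor :: "('a, 'b) dup_tensor" is 0 .

lift_definition plus_dup_tensor ::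
  "('a, 'b) dup_tensor \<Rightarrow> ('a, 'b) dup_tensor \<Rightarrow> ('a, 'b) dup_tensor" is "(+)"
proof -
  fix p p' q q' :: "('a, 'b) dup \<times> ('a, 'b) dup \<Rightarrow>\<^sub>0 'b"
  assume "p - p' \<in> fvs.span (bilinear_relations dup_scale dup_scale)" "q - q' \<in> fvs.span (bilinear_relations dup_scale dup_scale)"
  then have "(p - p') + (q - q') \<in> fvs.span (bilinear_relations dup_scale dup_scale)" by (rule fvs.span_add)
  then show "(p + q) - (p' + q') \<in> fvs.span (bilinear_relations dup_scale dup_scale)" by (simp add: algebra_simps)
qed

lift_definition uminus_dup_tensor :: "('a, 'b) dup_tensor \<Rightarrow> ('a, 'b) dup_tensor" is uminus
proof -
  fix p p' :: "('a, 'b) dup \<times> ('a, 'b) dup \<Rightarrow>\<^sub>0 'b"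
  assume "p - p' \<in> fvs.span (bilinear_relations dup_scale dup_scale)"
  then have "- (p - p') \<in> fvs.span (bilinear_relations dup_scale dup_scale)" by (rule fvs.span_neg)
  then show "- p - (- p') \<in> fvs.span (bilinear_relations dup_scale dup_scale)" by simp
qed

lift_definition minus_dup_tensor ::
  "('a, 'b) dup_tensor \<Rightarrow> ('a, 'b) dup_tensor \<Rightarrow> ('a, 'b) dup_tensor" is "(-)"
proof -
  fix p p' q q' :: "('a, 'b) dup \<times> ('a, 'b) dup \<Rightarrow>\<^sub>0 'b"
  assume "p - p' \<in> fvs.span (bilinear_relations dup_scale dup_scale)" "q - q' \<in> fvs.span (bilinear_relations dup_scale dup_scale)"
  then have "(p - p') - (q - q') \<in> fvs.span (bilinear_relations dup_scale dup_scale)" by (rule fvs.span_diff)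
  then show "(p - q) - (p' - q') \<in> fvs.span (bilinear_relations dup_scale dup_scale)" by (simp add: algebra_simps)
qed

instance
  by standard (transfer, simp add: fvs.span_zero algebra_simps)+

end

lift_definition tensor_scale :: "'k::field \<Rightarrow> ('v, 'k) dup_tensor \<Rightarrow> ('v, 'k) dup_tensor" is fscale
  by (simp add: fvs.span_scale flip: fvs.scale_right_diff_distrib)

definition tensor :: "('v, 'k) dup \<Rightarrow> ('v, 'k) dup \<Rightarrow> ('v, 'k::field) dup_tensor"
    (infixr \<open>\<otimes>\<close> 70) where
  "x \<otimes> y = abs_dup_tensor (basis (x, y))"

interpretation tensor: vector_space
  "tensor_scale :: 'k::field \<Rightarrow> ('v, 'k) dup_tensor \<Rightarrow> ('v, 'k) dup_tensor"
  by standard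
    (transfer, simp add: fvs.scale_right_distrib fvs.scale_left_distrib fvs.span_zero)+

lemma tensor_add_left: "(x + x') \<otimes> y = x \<otimes> y + x' \<otimes> y"
proof -
  have "basis (x + x', y) - (basis (x, y) + basis (x', y))
      \<in> bilinear_relations dup_scale dup_scale"
    unfolding bilinear_relations_def diff_diff_add[symmetric] by blast
  then show ?thesis
    by (simp add: tensor_def plus_dup_tensor.abs_eq tensor_scale.abs_eq dup_tensor.abs_eq_iff
        fvs.span_base)
qed

lemma tensor_add_right: "x \<otimes> (y + y') = x \<otimes> y + x \<otimes> y'"
proof -
  have "basis (x, y + y') - (basis (x, y) + basis (x, y'))
      \<in> bilinear_relations dup_scale dup_scale"
    unfolding bilinear_relations_def diff_diff_add[symmetric] by blast
  then show ?thesis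
    by (simp add: tensor_def plus_dup_tensor.abs_eq tensor_scale.abs_eq dup_tensor.abs_eq_iff
        fvs.span_base)
qed

lemma tensor_scale_left: "dup_scale c x \<otimes> y = tensor_scale c (x \<otimes> y)"
proof -
  have "basis (dup_scale c x, y) - fscale c (basis (x, y))
      \<in> bilinear_relations dup_scale dup_scale"
    unfolding bilinear_relations_def diff_diff_add[symmetric] by blast
  then show ?thesis
    by (simp add: tensor_def plus_dup_tensor.abs_eq tensor_scale.abs_eq dup_tensor.abs_eq_iff
        fvs.span_base)
qed

lemma tensor_scale_right: "x \<otimes> dup_scale c y = tensor_scale c (x \<otimes> y)"
proof -
  have "basis (x, dup_scale c y) - fscale c (basis (x, y))
      \<in> bilinear_relations dup_scale dup_scale"
    unfolding bilinear_relations_def diff_diff_add[symmetric] by blast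
  then show ?thesis
    by (simp add: tensor_def plus_dup_tensor.abs_eq tensor_scale.abs_eq dup_tensor.abs_eq_iff
        fvs.span_base)
qed

lemmas abs_rep_tensor = Quotient3_abs_rep[OF Quotient3_dup_tensor]

lemma tensor_induct [case_names zero add scale tensor]:
  fixes z :: "('v, 'k::field) dup_tensor"
  assumes "P 0" "\<And>w z. P w \<Longrightarrow> P z \<Longrightarrow> P (w + z)" "\<And>c z. P z \<Longrightarrow> P (tensor_scale c z)"
    "\<And>x y. P (x \<otimes> y)"
  shows "P z"
proof -
  have *: "P (abs_dup_tensor p)" for p :: "('v, 'k) dup \<times> ('v, 'k) dup \<Rightarrow>\<^sub>0 'k"
  proof (induction p rule: free_induct)
    case zero
    then show ?case using assms(1) by (simp add: zero_dup_tensor.abs_eq)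
  next
    case (add p q)
    then show ?case using assms(2) by (metis plus_dup_tensor.abs_eq)
  next
    case (scale c p)
    then show ?case using assms(3) by (metis tensor_scale.abs_eq)
  next
    case (basis b)
    then show ?case using assms(4) by (metis surj_pair tensor_def)
  qed
  show ?thesis
    using *[of "rep_dup_tensor z"] by (simp only: abs_rep_tensor)
qed

text \<open>The linear map induced by the bilinear map \<open>\<lambda>x y. f x \<otimes> g y\<close>, for linear \<open>f\<close> and \<open>g\<close>,
  again evaluated on a representative.\<close>

definition tensor_map :: "(('v, 'k) dup \<Rightarrow> ('v, 'k) dup) \<Rightarrow> (('v, 'k) dup \<Rightarrow> ('v, 'k) dup)
    \<Rightarrow> ('v, 'k::field) dup_tensor \<Rightarrow> ('v, 'k) dup_tensor" where
  "tensor_map f g z = lin_ext tensor_scale (\<lambda>(x, y). f x \<otimes> g y) (rep_dup_tensor z)"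

lemma tensor_map_abs:
  assumes "Vector_Spaces.linear dup_scale dup_scale f" "Vector_Spaces.linear dup_scale dup_scale g"
  shows "tensor_map f g (abs_dup_tensor p) = lin_ext tensor_scale (\<lambda>(x, y). f x \<otimes> g y) p"
proof -
  let ?e = "lin_ext tensor_scale (\<lambda>(x, y). f x \<otimes> g y)"
  interpret f: Vector_Spaces.linear dup_scale dup_scale f by fact
  interpret g: Vector_Spaces.linear dup_scale dup_scale g by fact
  interpret l: Vector_Spaces.linear fscale tensor_scale ?e
    by (rule linear_lin_ext) (rule tensor.vector_space_axioms)
  have "?e q = 0" if "q \<in> fvs.span (bilinear_relations dup_scale dup_scale)" for q
    using that
  proof (induction rule: fvs.span_induct_alt)
    case (step c x y)
    then show ?case
      by (auto simp: bilinear_relations_def l.add l.scale l.diff lin_ext_basis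
          tensor.vector_space_axioms f.add g.add f.scale g.scale tensor_add_left tensor_add_right
          tensor_scale_left tensor_scale_right)
  qed simp
  moreover have "rep_dup_tensor (abs_dup_tensor p) - p
      \<in> fvs.span (bilinear_relations dup_scale dup_scale)"
    using Quotient3_rep_abs[OF Quotient3_dup_tensor, of p] by (simp add: fvs.span_zero)
  ultimately have "?e (rep_dup_tensor (abs_dup_tensor p) - p) = 0" by blast
  then show ?thesis by (simp add: tensor_map_def l.diff)
qed

context
  fixes f g :: "('v, 'k::field) dup \<Rightarrow> ('v, 'k) dup"
  assumes f: "Vector_Spaces.linear dup_scale dup_scale f"
    and g: "Vector_Spaces.linear dup_scale dup_scale g"
begin

lemma tensor_map_tensor: "tensor_map f g (x \<otimes> y) = f x \<otimes> g y"
  using tensor_map_abs[OF f g, of "basis (x, y)"]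
  by (simp add: tensor_def lin_ext_basis tensor.vector_space_axioms)

lemma tensor_map_add: "tensor_map f g (w + z) = tensor_map f g w + tensor_map f g z"
  using tensor_map_abs[OF f g, of "rep_dup_tensor w + rep_dup_tensor z"]
  by (simp add: plus_dup_tensor.abs_eq[symmetric] abs_rep_tensor lin_ext_add
      tensor.vector_space_axioms) (simp add: tensor_map_def)

lemma tensor_map_scale: "tensor_map f g (tensor_scale c z) = tensor_scale c (tensor_map f g z)"
  using tensor_map_abs[OF f g, of "fscale c (rep_dup_tensor z)"]
  by (simp add: tensor_scale.abs_eq[symmetric] abs_rep_tensor lin_ext_scale
      tensor.vector_space_axioms) (simp add: tensor_map_def)

end

lemma linear_mult_left: "Vector_Spaces.linear dup_scale dup_scale (\<lambda>u. dup_mult b u y)"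
  by unfold_locales (simp_all add: dup.mul_add_left dup.mul_scale_left)

lemma linear_mult_right: "Vector_Spaces.linear dup_scale dup_scale (dup_mult b x)"
  by unfold_locales (simp_all add: dup.mul_add_right dup.mul_scale_right)

lemma linear_id: "Vector_Spaces.linear dup_scale dup_scale (\<lambda>u. u)"
  by unfold_locales simp_all

text \<open>The actions \<open>(z\<^sub>1 \<otimes> z\<^sub>2, y) \<mapsto> z\<^sub>1 \<otimes> (z\<^sub>2 \<circ> y)\<close> and \<open>(x, z\<^sub>1 \<otimes> z\<^sub>2) \<mapsto> (x \<circ> z\<^sub>1) \<otimes> z\<^sub>2\<close> of an algebra on its
  tensor square.\<close>

definition act_right :: "dup_op \<Rightarrow> ('v, 'k) dup_tensor \<Rightarrow> ('v, 'k) dup \<Rightarrow> ('v, 'k::field) dup_tensor"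
  where "act_right b z y = tensor_map (\<lambda>u. u) (\<lambda>u. dup_mult b u y) z"

definition act_left :: "dup_op \<Rightarrow> ('v, 'k) dup \<Rightarrow> ('v, 'k) dup_tensor \<Rightarrow> ('v, 'k::field) dup_tensor"
  where "act_left b x z = tensor_map (\<lambda>u. dup_mult b x u) (\<lambda>u. u) z"

lemma act_right_simps [simp]:
  "act_right b (u \<otimes> v) y = u \<otimes> dup_mult b v y"
  "act_right b (w + z) y = act_right b w y + act_right b z y"
  "act_right b (tensor_scale c z) y = tensor_scale c (act_right b z y)"
  by (simp_all add: act_right_def tensor_map_tensor[OF linear_id linear_mult_left]
      tensor_map_add[OF linear_id linear_mult_left] tensor_map_scale[OF linear_id linear_mult_left])

lemma act_left_simps [simp]:
  "act_left b x (u \<otimes> v) = dup_mult b x u \<otimes> v"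
  "act_left b x (w + z) = act_left b x w + act_left b x z"
  "act_left b x (tensor_scale c z) = tensor_scale c (act_left b x z)"
  by (simp_all add: act_left_def tensor_map_tensor[OF linear_mult_right linear_id]
      tensor_map_add[OF linear_mult_right linear_id]
      tensor_map_scale[OF linear_mult_right linear_id])

lemma act_zero [simp]: "act_right b 0 y = 0" "act_left b x 0 = 0"
  using act_right_simps(3)[of b 0 0 y] act_left_simps(3)[of b x 0 0] by simp_all

lemma tensor_zero [simp]: "0 \<otimes> y = 0" "x \<otimes> 0 = 0"
  using tensor_scale_left[of 0 0 y] tensor_scale_right[of x 0 0] by simp_all

lemma act_param_simps:
  "act_right b z (y + y') = act_right b z y + act_right b z y'"
  "act_right b z (dup_scale c y) = tensor_scale c (act_right b z y)"
  "act_right b z 0 = 0"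
  "act_left b (x + x') z = act_left b x z + act_left b x' z"
  "act_left b (dup_scale c x) z = tensor_scale c (act_left b x z)"
  "act_left b 0 z = 0"
  by (induction z rule: tensor_induct;
      simp add: dup.mul_add_left dup.mul_add_right dup.mul_scale_left dup.mul_scale_right
        tensor_add_left tensor_add_right tensor_scale_left tensor_scale_right
        tensor.scale_right_distrib ac_simps)+

text \<open>The coproduct is the unique linear map on \<open>Dup(V)\<close> that vanishes on generators and satisfies
  \<open>\<delta>(x \<circ> y) = x \<otimes> y + x\<^sub>1 \<otimes> (x\<^sub>2 \<circ> y) + (x \<circ> y\<^sub>1) \<otimes> y\<^sub>2\<close> for both operations (lemmas \<open>linear_dup_delta\<close>,
  \<open>dup_delta_gen\<close>, \<open>dup_delta_mult\<close>). It is computed by recursion on monomials; by \<open>dup_delta_abs\<close>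
  the result does not depend on the representative.\<close>

primrec delta_tree :: "(dup_op, 'v) bintree \<Rightarrow> ('v, 'k::field) dup_tensor" where
  "delta_tree (Leaf v) = 0"
| "delta_tree (Node b s t) =
     (let x = abs_dup (basis s); y = abs_dup (basis t) in
       x \<otimes> y + act_right b (delta_tree s) y
         + act_left b x (delta_tree t))"

definition dup_delta :: "('v, 'k) dup \<Rightarrow> ('v, 'k::field) dup_tensor" where
  "dup_delta x = lin_ext tensor_scale delta_tree (rep_dup x)"

lemma delta_free_graft:
  fixes p q :: "(dup_op, 'v) bintree \<Rightarrow>\<^sub>0 'k::field"
  defines "d \<equiv> lin_ext tensor_scale delta_tree"
  shows "d (graft b p q) = abs_dup p \<otimes> abs_dup q
    + act_right b (d p) (abs_dup q)
    + act_left b (abs_dup p) (d q)"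
proof -
  note [simp] = lin_ext_add lin_ext_scale lin_ext_basis tensor.vector_space_axioms
    graft_add_left graft_add_right graft_scale_left graft_scale_right graft_basis
    act_param_simps tensor_add_left tensor_add_right tensor_scale_left tensor_scale_right
    plus_dup.abs_eq[symmetric] dup_scale.abs_eq[symmetric] zero_dup_def[symmetric]
  have z: "d 0 = 0" by (simp add: d_def lin_ext_def)
  show ?thesis
  proof (induction p rule: free_induct)
    case (basis s)
    show ?case
      by (induction q rule: free_induct)
        (simp_all add: z, simp_all add: d_def tensor.scale_right_distrib Let_def algebra_simps)
  qed (simp_all add: z, simp_all add: d_def tensor.scale_right_distrib algebra_simps)
qed

lemma delta_ideal:
  fixes p :: "(dup_op, 'v) bintree \<Rightarrow>\<^sub>0 'k::field"
  assumes "p \<in> dup_ideal"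
  shows "lin_ext tensor_scale delta_tree p = 0"
proof -
  let ?d = "lin_ext tensor_scale delta_tree"
  interpret l: Vector_Spaces.linear fscale tensor_scale ?d
    by (rule linear_lin_ext) (rule tensor.vector_space_axioms)
  have 0: "abs_dup q = 0" if "q \<in> dup_ideal" for q :: "(dup_op, 'v) bintree \<Rightarrow>\<^sub>0 'k"
    using that by (simp add: zero_dup_def dup.abs_eq_iff)
  have rel: "?d (graft b' (graft b p q) r - graft b p (graft b' q r)) = 0"
    if "\<And>x y z :: ('v, 'k) dup. dup_mult b' (dup_mult b x y) z = dup_mult b x (dup_mult b' y z)"
    for b b' and p q r :: "(dup_op, 'v) bintree \<Rightarrow>\<^sub>0 'k"
  proof -
    have *: "abs_dup (graft b p q) = dup_mult b (abs_dup p) (abs_dup q)" for b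
      and p q :: "(dup_op, 'v) bintree \<Rightarrow>\<^sub>0 'k"
      by (simp add: dup_mult.abs_eq)
    have 1: "act_right b' (act_right b w y) z =
        act_right b w (dup_mult b' y z)" for w and y z :: "('v, 'k) dup"
      by (induction w rule: tensor_induct) (simp_all add: that)
    have 2: "act_left b' (dup_mult b x y) w =
        act_left b x (act_left b' y w)"
      for w and x y :: "('v, 'k) dup"
      by (induction w rule: tensor_induct) (simp_all add: that)
    have 3: "act_right b' (act_left b x w) z =
        act_left b x (act_right b' w z)"
      for w and x z :: "('v, 'k) dup"
      by (induction w rule: tensor_induct) simp_all
    show ?thesis
      by (simp add: l.diff delta_free_graft * 1 2 3 algebra_simps)
  qed
  from assms show ?thesis
    by induction
      (simp_all add: l.add l.scale delta_free_graft 0 act_param_simps rel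
        dup.prec_prec dup.succ_prec dup.succ_succ)
qed

lemma dup_delta_abs: "dup_delta (abs_dup p) = lin_ext tensor_scale delta_tree p"
proof -
  interpret l: Vector_Spaces.linear fscale tensor_scale "lin_ext tensor_scale delta_tree"
    by (rule linear_lin_ext) (rule tensor.vector_space_axioms)
  show ?thesis
    using delta_ideal[OF rep_abs_dup[of p]] by (simp add: dup_delta_def l.diff)
qed

lemma linear_dup_delta: "Vector_Spaces.linear dup_scale tensor_scale dup_delta"
proof unfold_locales
  fix x y :: "('v, 'k::field) dup" and c :: 'k
  show "dup_delta (x + y) = dup_delta x + dup_delta y"
    using dup_delta_abs[of "rep_dup x + rep_dup y"]
    by (simp add: plus_dup.abs_eq[symmetric] abs_rep_dup lin_ext_add tensor.vector_space_axioms
        dup_delta_def)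
  show "dup_delta (dup_scale c x) = tensor_scale c (dup_delta x)"
    using dup_delta_abs[of "fscale c (rep_dup x)"]
    by (simp add: dup_scale.abs_eq[symmetric] abs_rep_dup lin_ext_scale tensor.vector_space_axioms
        dup_delta_def)
qed

lemma dup_delta_gen: "dup_delta (dup_gen v) = 0"
  by (simp add: dup_gen_def dup_delta_abs lin_ext_basis tensor.vector_space_axioms)

lemma dup_delta_mult:
  "dup_delta (dup_mult b x y) = x \<otimes> y + act_right b (dup_delta x) y
     + act_left b x (dup_delta y)"
proof -
  have "dup_mult b x y = abs_dup (graft b (rep_dup x) (rep_dup y))"
    by (simp add: dup_mult.abs_eq[symmetric] abs_rep_dup)
  then show ?thesis
    by (simp add: dup_delta_abs delta_free_graft abs_rep_dup) (simp add: dup_delta_def)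
qed


section \<open>Operads\<close>

text \<open>The structure of a symmetric \<open>K\<close>-linear operad: the spaces of \<open>n\<close>-ary operations, the scalar
  multiplication, the identity operation, the composites
  \<open>\<gamma>(\<mu>; \<nu>\<^sub>1, \<dots>, \<nu>\<^sub>n)\<close>, where the list contains the arities of the \<open>\<nu>\<^sub>i\<close>, and the right action of
  permutations. Inputs are numbered from 0.\<close>

record ('k, 'p) operad =
  operations :: "nat \<Rightarrow> 'p set"
  op_scale :: "'k \<Rightarrow> 'p \<Rightarrow> 'p"
  op_id :: 'p
  op_comp :: "nat list \<Rightarrow> 'p \<Rightarrow> 'p list \<Rightarrow> 'p"
  op_act :: "'p \<Rightarrow> (nat \<Rightarrow> nat) \<Rightarrow> 'p"

definition composable :: "('k, 'p) operad \<Rightarrow> nat list \<Rightarrow> 'p \<Rightarrow> 'p list \<Rightarrow> bool" where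
  "composable P ks \<mu> \<nu>s \<longleftrightarrow> \<mu> \<in> operations P (length ks) \<and> length \<nu>s = length ks \<and>
     (\<forall>i<length ks. \<nu>s ! i \<in> operations P (ks ! i))"

definition suboperad :: "('k::field, 'p::ab_group_add) operad \<Rightarrow> ('k, 'p) operad \<Rightarrow> bool" where
  "suboperad Q P \<longleftrightarrow>
     Q = P\<lparr>operations := operations Q\<rparr> \<and>
     (\<forall>n. operations Q n \<subseteq> operations P n \<and> module.subspace (op_scale P) (operations Q n)) \<and>
     op_id P \<in> operations Q 1 \<and>
     (\<forall>ks \<mu> \<nu>s. composable Q ks \<mu> \<nu>s \<longrightarrow> op_comp P ks \<mu> \<nu>s \<in> operations Q (sum_list ks)) \<and>
     (\<forall>n \<mu> \<sigma>. \<mu> \<in> operations Q n \<and> \<sigma> permutes {..<n} \<longrightarrow> op_act P \<mu> \<sigma> \<in> operations Q n)"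

definition operad_hom :: "('k::field, 'p::ab_group_add) operad \<Rightarrow> ('k, 'q::ab_group_add) operad
    \<Rightarrow> (nat \<Rightarrow> 'p \<Rightarrow> 'q) \<Rightarrow> bool" where
  "operad_hom P Q \<Phi> \<longleftrightarrow>
     (\<forall>n. \<forall>\<mu>\<in>operations P n. \<Phi> n \<mu> \<in> operations Q n) \<and>
     (\<forall>n. \<forall>\<mu>\<in>operations P n. \<forall>\<nu>\<in>operations P n. \<Phi> n (\<mu> + \<nu>) = \<Phi> n \<mu> + \<Phi> n \<nu>) \<and>
     (\<forall>n c. \<forall>\<mu>\<in>operations P n. \<Phi> n (op_scale P c \<mu>) = op_scale Q c (\<Phi> n \<mu>)) \<and>
     \<Phi> 1 (op_id P) = op_id Q \<and>
     (\<forall>ks \<mu> \<nu>s. composable P ks \<mu> \<nu>s \<longrightarrow>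
        \<Phi> (sum_list ks) (op_comp P ks \<mu> \<nu>s) =
          op_comp Q ks (\<Phi> (length ks) \<mu>) (map2 \<Phi> ks \<nu>s)) \<and>
     (\<forall>n \<sigma>. \<forall>\<mu>\<in>operations P n. \<sigma> permutes {..<n} \<longrightarrow>
        \<Phi> n (op_act P \<mu> \<sigma>) = op_act Q (\<Phi> n \<mu>) \<sigma>)"

definition operad_iso :: "('k::field, 'p::ab_group_add) operad \<Rightarrow> ('k, 'q::ab_group_add) operad
    \<Rightarrow> (nat \<Rightarrow> 'p \<Rightarrow> 'q) \<Rightarrow> bool" where
  "operad_iso P Q \<Phi> \<longleftrightarrow>
     operad_hom P Q \<Phi> \<and> (\<forall>n. bij_betw (\<Phi> n) (operations P n) (operations Q n))"

text \<open>The operad of a type of algebras: the \<open>n\<close>-ary operations are the multilinear elements of the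
  free algebra on \<open>x\<^sub>0, \<dots>, x\<^bsub>n-1\<^esub>\<close>, which is regarded as a subalgebra of the free algebra on all
  \<open>x\<^sub>i\<close>. Composition is substitution after moving the variables of the inserted elements to
  consecutive blocks, and
  \<open>(\<mu> \<sigma>)(x\<^sub>0, \<dots>, x\<^bsub>n-1\<^esub>) = \<mu>(x\<^bsub>\<sigma>\<inverse>(0)\<^esub>, \<dots>, x\<^bsub>\<sigma>\<inverse>(n-1)\<^esub>)\<close>.\<close>

definition multilinear_trees :: "nat \<Rightarrow> ('o, nat) bintree set" where
  "multilinear_trees n = {t. distinct (leaves t) \<and> set (leaves t) = {..<n}}"

definition subst_operad :: "(nat \<Rightarrow> 'p set) \<Rightarrow> ('k \<Rightarrow> 'p \<Rightarrow> 'p) \<Rightarrow> (nat \<Rightarrow> 'p)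
    \<Rightarrow> ((nat \<Rightarrow> 'p) \<Rightarrow> 'p \<Rightarrow> 'p) \<Rightarrow> ('k, 'p) operad" where
  "subst_operad A scale gen subst =
     \<lparr>operations = A,
      op_scale = scale,
      op_id = gen 0,
      op_comp = (\<lambda>ks \<mu> \<nu>s.
        subst (\<lambda>i. subst (\<lambda>j. gen (j + sum_list (take i ks))) (\<nu>s ! i)) \<mu>),
      op_act = (\<lambda>\<mu> \<sigma>. subst (\<lambda>i. gen (inv \<sigma> i)) \<mu>)\<rparr>"

definition mag_operad :: "('k::field, (nat, 'k) mag) operad" where
  "mag_operad = subst_operad (\<lambda>n. fvs.span (basis ` multilinear_trees n))
     fscale mag_gen (mag_ext fscale mag_mult)"

definition dup_operad :: "('k::field, (nat, 'k) dup) operad" where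
  "dup_operad = subst_operad (\<lambda>n. dup.span ((\<lambda>t. abs_dup (basis t)) ` multilinear_trees n))
     dup_scale dup_gen (dup_ext dup_scale dup_prec dup_succ)"

definition prim_dup_operad :: "('k::field, (nat, 'k) dup) operad" where
  "prim_dup_operad =
     dup_operad\<lparr>operations := (\<lambda>n. {\<mu> \<in> operations dup_operad n. dup_delta \<mu> = 0})\<rparr>"


section \<open>Algebras over the operads\<close>

text \<open>The result of applying an \<open>n\<close>-ary operation to a list of \<open>n\<close> elements of an algebra.\<close>

definition mag_action :: "('k::field \<Rightarrow> 'a \<Rightarrow> 'a::ab_group_add) \<Rightarrow> ('a \<Rightarrow> 'a \<Rightarrow> 'a)
    \<Rightarrow> (nat, 'k) mag \<Rightarrow> 'a list \<Rightarrow> 'a" where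
  "mag_action scale mul \<mu> xs = mag_ext scale mul (\<lambda>i. xs ! i) \<mu>"

definition dup_action :: "('k::field \<Rightarrow> 'a \<Rightarrow> 'a::ab_group_add) \<Rightarrow> ('a \<Rightarrow> 'a \<Rightarrow> 'a)
    \<Rightarrow> ('a \<Rightarrow> 'a \<Rightarrow> 'a) \<Rightarrow> (nat, 'k) dup \<Rightarrow> 'a list \<Rightarrow> 'a" where
  "dup_action scale prec succ \<mu> xs = dup_ext scale prec succ (\<lambda>i. xs ! i) \<mu>"

definition mag_hom :: "('k::field \<Rightarrow> 'a \<Rightarrow> 'a::ab_group_add) \<Rightarrow> ('a \<Rightarrow> 'a \<Rightarrow> 'a)
    \<Rightarrow> ('k \<Rightarrow> 'b \<Rightarrow> 'b::ab_group_add) \<Rightarrow> ('b \<Rightarrow> 'b \<Rightarrow> 'b) \<Rightarrow> ('a \<Rightarrow> 'b) \<Rightarrow> bool" where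
  "mag_hom s mul s' mul' h \<longleftrightarrow>
     Vector_Spaces.linear s s' h \<and> (\<forall>x y. h (mul x y) = mul' (h x) (h y))"

definition dup_hom :: "('k::field \<Rightarrow> 'a \<Rightarrow> 'a::ab_group_add) \<Rightarrow> ('a \<Rightarrow> 'a \<Rightarrow> 'a)
    \<Rightarrow> ('a \<Rightarrow> 'a \<Rightarrow> 'a) \<Rightarrow> ('k \<Rightarrow> 'b \<Rightarrow> 'b::ab_group_add) \<Rightarrow> ('b \<Rightarrow> 'b \<Rightarrow> 'b)
    \<Rightarrow> ('b \<Rightarrow> 'b \<Rightarrow> 'b) \<Rightarrow> ('a \<Rightarrow> 'b) \<Rightarrow> bool" where
  "dup_hom s prec succ s' prec' succ' h \<longleftrightarrow>
     mag_hom s prec s' prec' h \<and> mag_hom s succ s' succ' h"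

end

(* The model for Dup(V) is the space of nonempty words in magmatic trees. There x \<succ> y is
   concatenation, and x \<prec> y - x \<succ> y restricts to grafting on words of length one; the duplicial
   axioms force the remaining values. The coproduct becomes deconcatenation, whose kernel consists of
   the words of length one, i.e. of the free magmatic algebra. Thus the primitive elements of Dup(V)
   form the free magmatic algebra on V, and every operadic statement follows by restricting to
   multilinear elements. *)

theory Submission
  imports Defs "HOL-Library.Multiset"
begin

section \<open>Linear and bilinear extension\<close>

text \<open>The quotient Dup(V) comes without a basis, so injectivity of the map from the free
  magmatic algebra cannot be read off from representatives; the word model supplies a left inverse.
  The obstacle is the product a \<cdot> w of a letter and a word: its defining identity applies the
  product again to the words occurring in b \<cdot> u, which are not subterms but are no longer than
  u. This is why supports of products are bounded in size before anything is proved about them. The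
  coproduct is not transported to the model: it is evaluated in Dup(V), on the images of words. The
  compatibility of actions is asserted for every isomorphism with the prescribed value on the
  generator, so a morphism out of Mag must also be shown to be determined by that value.\<close>

lemma lin_ext_fscale [simp]:
  "lin_ext fscale f (0 :: 'b \<Rightarrow>\<^sub>0 'k::field) = 0"
  "lin_ext fscale f (p + q) = lin_ext fscale f p + lin_ext fscale f q"
  "lin_ext fscale f (fscale c p) = fscale c (lin_ext fscale f p)"
  "lin_ext fscale f (basis b) = f b"
  by (simp_all add: lin_ext_add lin_ext_scale lin_ext_basis fvs.vector_space_axioms)
    (simp add: lin_ext_def)

lemma lin_ext_fscale_diff [simp]:
  "lin_ext fscale f (p - q) = lin_ext fscale f p - lin_ext fscale f (q :: 'b \<Rightarrow>\<^sub>0 'k::field)"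
  by (metis add_diff_cancel diff_add_cancel lin_ext_fscale(2))

lemma lin_ext_cong:
  assumes "\<And>b. b \<in> Poly_Mapping.keys p \<Longrightarrow> f b = g b"
  shows "lin_ext s f p = lin_ext s g p"
  unfolding lin_ext_def using assms by (intro sum.cong) auto

lemma lin_ext_basis_id: "lin_ext fscale basis p = p"
  by (induction p rule: free_induct) simp_all

lemma linear_eq_lin_ext:
  assumes "Vector_Spaces.linear fscale s f"
  shows "f p = lin_ext s (\<lambda>b. f (basis b)) p"
proof -
  interpret f: Vector_Spaces.linear fscale s f by fact
  show ?thesis
    by (induction p rule: free_induct)
      (simp_all add: f.add f.scale f.zero lin_ext_add lin_ext_scale lin_ext_basis
        f.vs2.vector_space_axioms, simp add: lin_ext_def)
qed

text \<open>Comparison on the support alone is what inductions on word length need: their hypothesis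
  is available only for the words that occur in a given product.\<close>

lemma linear_eq_on_keys:
  assumes "Vector_Spaces.linear fscale s f" "Vector_Spaces.linear fscale s g"
    and "\<And>b. b \<in> Poly_Mapping.keys p \<Longrightarrow> f (basis b) = g (basis b)"
  shows "f p = g p"
proof -
  have "f p = lin_ext s (\<lambda>b. f (basis b)) p"
    by (rule linear_eq_lin_ext) (rule assms(1))
  also have "\<dots> = lin_ext s (\<lambda>b. g (basis b)) p"
    by (rule lin_ext_cong) (rule assms(3))
  also have "\<dots> = g p"
    by (rule linear_eq_lin_ext[symmetric]) (rule assms(2))
  finally show ?thesis .
qed

lemma keys_basis [simp]: "Poly_Mapping.keys (basis b :: 'b \<Rightarrow>\<^sub>0 'k::field) = {b}"
  by (simp add: basis_def)

lemma keys_lin_ext_subset: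
  assumes "\<And>b. b \<in> Poly_Mapping.keys p \<Longrightarrow> Poly_Mapping.keys (f b) \<subseteq> S"
  shows "Poly_Mapping.keys (lin_ext fscale f p) \<subseteq> S"
proof
  fix x assume "x \<in> Poly_Mapping.keys (lin_ext fscale f p)"
  then have "(\<Sum>b\<in>Poly_Mapping.keys p. Poly_Mapping.lookup p b * Poly_Mapping.lookup (f b) x) \<noteq> 0"
    by (simp add: in_keys_iff lin_ext_def lookup_sum)
  then obtain b where "b \<in> Poly_Mapping.keys p" "Poly_Mapping.lookup (f b) x \<noteq> 0"
    by (rule sum.not_neutral_contains_not_neutral) auto
  with assms[of b] show "x \<in> S" by (auto simp flip: in_keys_iff)
qed

lemma keys_add_subset:
  assumes "Poly_Mapping.keys p \<subseteq> S" "Poly_Mapping.keys q \<subseteq> S"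
  shows "Poly_Mapping.keys (p + q) \<subseteq> S"
  using assms keys_add[of p q] by auto

lemma keys_diff_subset:
  fixes p q :: "'b \<Rightarrow>\<^sub>0 'k::ab_group_add"
  assumes "Poly_Mapping.keys p \<subseteq> S" "Poly_Mapping.keys q \<subseteq> S"
  shows "Poly_Mapping.keys (p - q) \<subseteq> S"
  using assms keys_diff[of p q] by auto

lemma keys_fscale_subset: "Poly_Mapping.keys (fscale c p) \<subseteq> Poly_Mapping.keys p"
  by (auto simp: in_keys_iff)

text \<open>Turns membership in an arity component of Mag into a condition on supports.\<close>

lemma span_basis: "p \<in> fvs.span (basis ` S) \<longleftrightarrow> Poly_Mapping.keys (p :: 'b \<Rightarrow>\<^sub>0 'k::field) \<subseteq> S"
proof
  assume "p \<in> fvs.span (basis ` S)"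
  then show "Poly_Mapping.keys p \<subseteq> S"
  proof (induction rule: fvs.span_induct_alt)
    case (step c x y)
    then show ?case
      by (intro keys_add_subset order.trans[OF keys_fscale_subset]) auto
  qed simp
next
  assume *: "Poly_Mapping.keys p \<subseteq> S"
  have "lin_ext fscale basis p \<in> fvs.span (basis ` S)"
    unfolding lin_ext_def
    by (intro fvs.span_sum fvs.span_scale fvs.span_base) (use * in auto)
  then show "p \<in> fvs.span (basis ` S)" by (simp add: lin_ext_basis_id)
qed

section \<open>Bilinear maps given on basis elements\<close>

definition bilin_ext ::
    "('a \<Rightarrow> 'b \<Rightarrow> 'c \<Rightarrow>\<^sub>0 'k) \<Rightarrow> ('a \<Rightarrow>\<^sub>0 'k) \<Rightarrow> ('b \<Rightarrow>\<^sub>0 'k) \<Rightarrow> ('c \<Rightarrow>\<^sub>0 'k::field)" where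
  "bilin_ext f p q = lin_ext fscale (\<lambda>a. lin_ext fscale (f a) q) p"

lemma bilin_ext_basis_left [simp]: "bilin_ext f (basis a) q = lin_ext fscale (f a) q"
  by (simp add: bilin_ext_def)

lemma bilin_ext_left [simp]:
  "bilin_ext f 0 q = 0"
  "bilin_ext f (p + p') q = bilin_ext f p q + bilin_ext f p' q"
  "bilin_ext f (p - p') q = bilin_ext f p q - bilin_ext f p' q"
  "bilin_ext f (fscale c p) q = fscale c (bilin_ext f p q)"
  by (simp_all add: bilin_ext_def)

lemma bilin_ext_right [simp]:
  "bilin_ext f p 0 = 0"
  "bilin_ext f p (q + q') = bilin_ext f p q + bilin_ext f p q'"
  "bilin_ext f p (fscale c q) = fscale c (bilin_ext f p q)"
  by (induction p rule: free_induct; simp add: algebra_simps fvs.scale_right_distrib)+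

lemma mag_algebra_bilin_ext: "mag_algebra fscale (bilin_ext f)"
  by unfold_locales simp_all

section \<open>The duplicial algebra of words in magmatic trees\<close>

text \<open>The base case is a letter because Dup(V) has no unit, hence no empty word.
  \<open>Prepend a w\<close> models a \<succ> w.\<close>

datatype 'a word = Single 'a | Prepend 'a "'a word"

primrec word_append :: "'a word \<Rightarrow> 'a word \<Rightarrow> 'a word" where
  "word_append (Single a) w = Prepend a w"
| "word_append (Prepend a u) w = Prepend a (word_append u w)"

primrec word_leaves :: "('o, 'v) bintree word \<Rightarrow> 'v multiset" where
  "word_leaves (Single a) = mset (leaves a)"
| "word_leaves (Prepend a w) = mset (leaves a) + word_leaves w"

lemma word_leaves_append: "word_leaves (word_append u w) = word_leaves u + word_leaves w"
  by (induction u) (simp_all add: add.assoc)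

type_synonym ('v, 'k) words = "(unit, 'v) bintree word \<Rightarrow>\<^sub>0 'k"

text \<open>In a duplicial algebra \<open>x \<cdot> y = x \<prec> y - x \<succ> y\<close> satisfies
  \<open>a \<cdot> (b \<succ> w) = (a \<cdot> b) \<succ> w + (a \<cdot> b) \<cdot> w - a \<cdot> (b \<cdot> w)\<close>. Since \<open>b \<cdot> w\<close> is a combination of words
  that are no longer than \<open>w\<close>, this determines the product of a letter and a word by recursion on the
  length of the word. The first argument bounds the recursion depth.\<close>

primrec letter_dot_depth :: "nat \<Rightarrow> (unit, 'v) bintree \<Rightarrow> (unit, 'v) bintree word
    \<Rightarrow> ('v, 'k::field) words" where
  "letter_dot_depth 0 a w =
     (case w of Single b \<Rightarrow> basis (Single (Node () a b)) | Prepend b u \<Rightarrow> 0)"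
| "letter_dot_depth (Suc n) a w =
     (case w of Single b \<Rightarrow> basis (Single (Node () a b))
      | Prepend b u \<Rightarrow> basis (Prepend (Node () a b) u) + letter_dot_depth n (Node () a b) u
          - lin_ext fscale (letter_dot_depth n a) (letter_dot_depth n b u))"

definition letter_dot :: "(unit, 'v) bintree \<Rightarrow> (unit, 'v) bintree word
    \<Rightarrow> ('v, 'k::field) words" where
  "letter_dot a w = letter_dot_depth (size w) a w"

text \<open>This bound justifies the nested recursion: the inner product of b and u yields only
  words no longer than u, to which the outer product can be applied with one level of depth
  less.\<close>

lemma keys_letter_dot_depth_size:
  "Poly_Mapping.keys (letter_dot_depth n a w :: ('v, 'k::field) words) \<subseteq> {u. size u \<le> size w}"
proof (induction n arbitrary: a w)
  case (Suc n)
  show ?case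
  proof (cases w)
    case (Prepend b u)
    have "Poly_Mapping.keys (letter_dot_depth n c u' :: ('v, 'k) words) \<subseteq> {v. size v \<le> size w}"
      if "size u' \<le> size u" for c u'
      using Suc.IH[of c u'] that Prepend by auto
    moreover have "size v \<le> size u"
      if "v \<in> Poly_Mapping.keys (letter_dot_depth n b u :: ('v, 'k) words)" for v
      using Suc.IH[of b u] that by auto
    ultimately show ?thesis
      unfolding Prepend letter_dot_depth.simps word.case
      by (intro keys_add_subset keys_diff_subset keys_lin_ext_subset) (simp_all add: Prepend)
  qed simp
qed (simp split: word.split)

text \<open>Each term of the recursion uses the same letters, so the product is homogeneous in the
  leaves. Multilinearity of operations is later read off from this grading.\<close>

lemma keys_letter_dot_depth_leaves:
  "Poly_Mapping.keys (letter_dot_depth n a w :: ('v, 'k::field) words)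
    \<subseteq> {u. word_leaves u = mset (leaves a) + word_leaves w}"
proof (induction n arbitrary: a w)
  case (Suc n)
  show ?case
  proof (cases w)
    case (Prepend b u)
    have "Poly_Mapping.keys (letter_dot_depth n c u' :: ('v, 'k) words)
        \<subseteq> {v. word_leaves v = mset (leaves a) + word_leaves w}"
      if "mset (leaves c) + word_leaves u' = mset (leaves a) + word_leaves w" for c u'
      using Suc.IH[of c u'] that by auto
    moreover have "word_leaves v = word_leaves w"
      if "v \<in> Poly_Mapping.keys (letter_dot_depth n b u :: ('v, 'k) words)" for v
      using Suc.IH[of b u] that Prepend by auto
    ultimately show ?thesis
      unfolding Prepend letter_dot_depth.simps word.case
      by (intro keys_add_subset keys_diff_subset keys_lin_ext_subset) (simp_all add: Prepend)
  qed simp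
qed (simp split: word.split)

text \<open>Depth at least the size of the word is enough: every recursive call, including the one
  on words of an inner product, is on words no longer than the tail.\<close>

lemma letter_dot_depth_stable:
  "size w \<le> m \<Longrightarrow> m \<le> n \<Longrightarrow>
    (letter_dot_depth n a w :: ('v, 'k::field) words) = letter_dot_depth m a w"
proof (induction n arbitrary: m a w)
  case (Suc n)
  show ?case
  proof (cases w)
    case (Single b)
    then show ?thesis by (cases m) simp_all
  next
    case (Prepend b u)
    with Suc.prems obtain m' where m: "m = Suc m'" "size u \<le> m'" "m' \<le> n"
      by (cases m) auto
    have "lin_ext fscale (letter_dot_depth n a) (letter_dot_depth m' b u :: ('v, 'k) words)
        = lin_ext fscale (letter_dot_depth m' a) (letter_dot_depth m' b u :: ('v, 'k) words)"
    proof (rule lin_ext_cong)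
      fix v assume "v \<in> Poly_Mapping.keys (letter_dot_depth m' b u :: ('v, 'k) words)"
      then have "size v \<le> m'" using keys_letter_dot_depth_size[of m' b u] m by auto
      then show "(letter_dot_depth n a v :: ('v, 'k) words) = letter_dot_depth m' a v"
        using m by (intro Suc.IH) auto
    qed
    then show ?thesis
      by (simp only: m(1) Prepend letter_dot_depth.simps word.case Suc.IH[OF m(2,3)])
  qed
next
  case 0
  then show ?case by (simp only: le_zero_eq)
qed

lemma keys_letter_dot_size:
  "u \<in> Poly_Mapping.keys (letter_dot a w :: ('v, 'k::field) words) \<Longrightarrow> size u \<le> size w"
  using keys_letter_dot_depth_size[of "size w" a w] by (auto simp: letter_dot_def)

lemma letter_dot_Single: "letter_dot a (Single b) = basis (Single (Node () a b))"
  by (simp add: letter_dot_def)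

text \<open>The recursion freed of its depth bound. The words of the inner product have size at most
  \<open>size w\<close>, so the common depth \<open>size w\<close> already gives their true
  products.\<close>

lemma letter_dot_Prepend:
  "(letter_dot a (Prepend b w) :: ('v, 'k::field) words) =
     basis (Prepend (Node () a b) w) + letter_dot (Node () a b) w
     - lin_ext fscale (letter_dot a) (letter_dot b w)"
proof -
  have "lin_ext fscale (letter_dot_depth (size w) a) (letter_dot_depth (size w) b w :: ('v, 'k) words)
      = lin_ext fscale (letter_dot a) (letter_dot_depth (size w) b w)"
  proof (rule lin_ext_cong)
    fix v assume "v \<in> Poly_Mapping.keys (letter_dot_depth (size w) b w :: ('v, 'k) words)"
    then have "size v \<le> size w" using keys_letter_dot_depth_size[of "size w" b w] by auto
    then show "(letter_dot_depth (size w) a v :: ('v, 'k) words) = letter_dot a v"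
      unfolding letter_dot_def by (intro letter_dot_depth_stable) auto
  qed
  moreover have "size (Prepend b w) = Suc (size w)" by simp
  ultimately show ?thesis
    by (simp only: letter_dot_def[of a "Prepend b w"] letter_dot_def[of "Node () a b" w]
        letter_dot_def[of b w] letter_dot_depth.simps word.case)
qed

section \<open>The two products on words\<close>

definition prepend :: "(unit, 'v) bintree \<Rightarrow> ('v, 'k::field) words \<Rightarrow> ('v, 'k) words" where
  "prepend a = lin_ext fscale (\<lambda>w. basis (Prepend a w))"

lemma prepend_linear [simp]:
  "prepend a 0 = 0"
  "prepend a (p + q) = prepend a p + prepend a q"
  "prepend a (p - q) = prepend a p - prepend a q"
  "prepend a (fscale c p) = fscale c (prepend a p)"
  by (simp_all add: prepend_def)

lemma basis_Prepend: "basis (Prepend a w) = prepend a (basis w)"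
  by (simp add: prepend_def)

abbreviation word_dot :: "(unit, 'v) bintree \<Rightarrow> ('v, 'k::field) words \<Rightarrow> ('v, 'k) words" where
  "word_dot a \<equiv> lin_ext fscale (letter_dot a)"

text \<open>The first clause is a \<prec> w = a \<succ> w + a \<cdot> w; the second is forced by the
  axiom (a \<succ> u) \<prec> w = a \<succ> (u \<prec> w).\<close>

primrec word_mult_prec :: "(unit, 'v) bintree word \<Rightarrow> (unit, 'v) bintree word
    \<Rightarrow> ('v, 'k::field) words" where
  "word_mult_prec (Single a) w = basis (Prepend a w) + letter_dot a w"
| "word_mult_prec (Prepend a u) w = prepend a (word_mult_prec u w)"

definition word_prec :: "('v, 'k::field) words \<Rightarrow> ('v, 'k) words \<Rightarrow> ('v, 'k) words" where
  "word_prec = bilin_ext word_mult_prec"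

definition word_succ :: "('v, 'k::field) words \<Rightarrow> ('v, 'k) words \<Rightarrow> ('v, 'k) words" where
  "word_succ = bilin_ext (\<lambda>u w. basis (word_append u w))"

interpretation word_prec: mag_algebra fscale word_prec
  unfolding word_prec_def by (rule mag_algebra_bilin_ext)

interpretation word_succ: mag_algebra fscale word_succ
  unfolding word_succ_def by (rule mag_algebra_bilin_ext)

lemmas word_prec_linear = word_prec.mul_add_left word_prec.mul_add_right word_prec.mul_scale_left
  word_prec.mul_scale_right word_prec.mul_diff_left word_prec.mul_diff_right

lemmas word_succ_linear = word_succ.mul_add_left word_succ.mul_add_right word_succ.mul_scale_left
  word_succ.mul_scale_right word_succ.mul_diff_left word_succ.mul_diff_right

lemma dot_prepend:
  "word_dot a (prepend b p)
    = prepend (Node () a b) p + word_dot (Node () a b) p - word_dot a (word_dot b p)"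
  by (induction p rule: free_induct)
    (simp_all add: letter_dot_Prepend prepend_def fvs.scale_right_distrib
      fvs.scale_right_diff_distrib)

lemma word_prec_Single: "word_prec (basis (Single a)) p = prepend a p + word_dot a p"
  by (induction p rule: free_induct) (simp_all add: word_prec_linear fvs.scale_right_distrib,
      simp add: word_prec_def prepend_def)

lemma word_succ_Single: "word_succ (basis (Single a)) p = prepend a p"
  by (simp add: word_succ_def prepend_def)

lemma word_prec_prepend: "word_prec (prepend a p) q = prepend a (word_prec p q)"
proof (induction p rule: free_induct)
  case (basis u)
  show ?case
    by (induction q rule: free_induct) (simp_all add: word_prec_linear,
        simp add: word_prec_def prepend_def)
qed (simp_all add: word_prec_linear)

lemma word_succ_prepend: "word_succ (prepend a p) q = prepend a (word_succ p q)"
proof (induction p rule: free_induct)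
  case (basis u)
  show ?case
    by (induction q rule: free_induct) (simp_all add: word_succ_linear,
        simp add: word_succ_def prepend_def)
qed (simp_all add: word_succ_linear)

text \<open>In a duplicial algebra (a \<cdot> w) \<prec> z = a \<cdot> (w \<prec> z) follows from
  the axioms; in the model it must come first, since associativity of \<prec> reduces to it.
  Induction on the length of w, expanding the product of a with a longer word on both sides.\<close>

lemma letter_dot_word_prec:
  fixes z :: "('v, 'k::field) words"
  shows "word_prec (letter_dot a w) z = word_dot a (word_prec (basis w) z)"
proof (induction "size w" arbitrary: a w rule: less_induct)
  case (less w)
  show ?case
  proof (cases w)
    case (Single c)
    \<comment> \<open>Expanding a \<cdot> (c \<succ> z) yields the term -a \<cdot> (c \<cdot> z),
      which cancels the contribution of c \<cdot> z to c \<prec> z.\<close>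
    then show ?thesis by (simp add: letter_dot_Single word_prec_Single dot_prepend)
  next
    case (Prepend c u)
    \<comment> \<open>The words of c \<cdot> u are shorter than w, so the induction hypothesis holds
      for each of them and linearity extends it to their combination.\<close>
    have *: "word_prec (word_dot a (letter_dot c u)) z = word_dot a (word_prec (letter_dot c u) z)"
    proof (rule linear_eq_on_keys[where f = "\<lambda>p. word_prec (word_dot a p) z"
            and g = "\<lambda>p. word_dot a (word_prec p z)"])
      show "Vector_Spaces.linear fscale fscale (\<lambda>p. word_prec (word_dot a p) z)"
        by unfold_locales (simp_all add: word_prec_linear)
      show "Vector_Spaces.linear fscale fscale (\<lambda>p. word_dot a (word_prec p z))"
        by unfold_locales (simp_all add: word_prec_linear)
      fix v assume "v \<in> Poly_Mapping.keys (letter_dot c u :: ('v, 'k) words)"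
      from keys_letter_dot_size[OF this] have "size v < size w" using Prepend by simp
      then show "word_prec (word_dot a (basis v)) z = word_dot a (word_prec (basis v) z)"
        by (simp add: less.hyps)
    qed
    have u: "word_prec (word_dot b (basis u)) z = word_dot b (word_prec (basis u) z)" for b
      using less.hyps[of u b] Prepend by simp
    with * have **: "word_prec (word_dot a (word_dot c (basis u))) z
        = word_dot a (word_dot c (word_prec (basis u) z))"
      by simp
    have "word_prec (letter_dot a w) z = word_prec (word_dot a (prepend c (basis u))) z"
      by (simp add: Prepend prepend_def)
    also have "\<dots> = word_dot a (prepend c (word_prec (basis u) z))"
      by (simp only: dot_prepend word_prec_linear word_prec_prepend u **)
    also have "\<dots> = word_dot a (word_prec (basis w) z)"
      by (simp only: Prepend basis_Prepend word_prec_prepend)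
    finally show ?thesis .
  qed
qed

lemma dot_word_prec: "word_prec (word_dot a p) z = word_dot a (word_prec p z)"
  by (induction p rule: free_induct) (simp_all add: word_prec_linear letter_dot_word_prec)

text \<open>Each axiom is proved by removing letters from the first argument. The operator
  \<open>prepend a\<close> passes through both products, so only the last letter needs work; there
  associativity of \<prec> rests on \<open>dot_word_prec\<close>.\<close>

interpretation words: dup_algebra fscale word_prec word_succ
proof
  fix x y z :: "('v, 'k::field) words"
  show "word_prec (word_prec x y) z = word_prec x (word_prec y z)"
  proof (induction x rule: free_induct)
    case (basis u)
    show ?case
      by (induction u) (simp_all only: basis_Prepend word_prec_prepend word_prec_Single
          word_prec_linear dot_word_prec)
  qed (simp_all add: word_prec_linear)
  show "word_prec (word_succ x y) z = word_succ x (word_prec y z)"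
  proof (induction x rule: free_induct)
    case (basis u)
    show ?case
      by (induction u) (simp_all only: basis_Prepend word_prec_prepend word_succ_prepend
          word_succ_Single)
  qed (simp_all add: word_prec_linear word_succ_linear)
  show "word_succ (word_succ x y) z = word_succ x (word_succ y z)"
  proof (induction x rule: free_induct)
    case (basis u)
    show ?case
      by (induction u) (simp_all only: basis_Prepend word_succ_prepend word_succ_Single)
  qed (simp_all add: word_succ_linear)
qed

section \<open>Algebra morphisms\<close>

context mag_algebra
begin

lemma mag_ext_basis: "mag_ext scale mul f (basis t) = tree_eval (\<lambda>_. mul) f t"
  by (simp add: mag_ext_def free_ext_def lin_ext_basis vector_space_axioms)

lemma mag_ext_gen: "mag_ext scale mul f (mag_gen v) = f v"
  by (simp add: mag_gen_def mag_ext_basis)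

lemma mag_hom_mag_ext: "mag_hom fscale mag_mult scale mul (mag_ext scale mul f)"
  unfolding mag_hom_def mag_ext_def
  by (auto simp: free_ext_def intro!: linear_lin_ext vector_space_axioms)
    (simp add: free_ext_graft mag_algebra_axioms flip: free_ext_def)

text \<open>Needed because inputs are read from lists with \<open>!\<close>, where values are known
  only at indices within range.\<close>

lemma mag_ext_cong:
  assumes "\<And>t i. t \<in> Poly_Mapping.keys \<mu> \<Longrightarrow> i \<in> set (leaves t) \<Longrightarrow> f i = g i"
  shows "mag_ext scale mul f \<mu> = mag_ext scale mul g \<mu>"
proof -
  have "tree_eval (\<lambda>_. mul) f t = tree_eval (\<lambda>_. mul) g t"
    if "\<forall>i\<in>set (leaves t). f i = g i" for t :: "(unit, 'b) bintree"
    using that by (induction t) auto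
  then show ?thesis
    unfolding mag_ext_def free_ext_def using assms by (intro lin_ext_cong) blast
qed

end

lemma mag_hom_simps:
  assumes "mag_hom s m s' m' h"
  shows "h 0 = 0" "h (x + y) = h x + h y" "h (x - y) = h x - h y" "h (s c x) = s' c (h x)"
    "h (m x y) = m' (h x) (h y)"
proof -
  interpret h: Vector_Spaces.linear s s' h
    using assms by (simp add: mag_hom_def)
  show "h 0 = 0" "h (x + y) = h x + h y" "h (x - y) = h x - h y" "h (s c x) = s' c (h x)"
    by (simp_all add: h.zero h.add h.diff h.scale)
  show "h (m x y) = m' (h x) (h y)"
    using assms by (simp add: mag_hom_def)
qed

text \<open>Uniqueness in the universal property: both sides are morphisms out of the free magmatic
  algebra with the same values on generators.\<close>

lemma mag_hom_mag_ext_comp: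
  assumes "mag_algebra s m" "mag_algebra s' m'" "mag_hom s m s' m' h"
  shows "h (mag_ext s m f \<mu>) = mag_ext s' m' (\<lambda>i. h (f i)) \<mu>"
proof -
  interpret m: mag_algebra s m by fact
  interpret m': mag_algebra s' m' by fact
  note [simp] = mag_hom_simps[OF m.mag_hom_mag_ext] mag_hom_simps[OF m'.mag_hom_mag_ext]
    mag_hom_simps[OF assms(3)]
  show ?thesis
  proof (induction \<mu> rule: free_induct)
    case (basis t)
    have "h (tree_eval (\<lambda>_. m) f t) = tree_eval (\<lambda>_. m') (\<lambda>i. h (f i)) t"
      by (induction t) simp_all
    then show ?case by (simp add: m.mag_ext_basis m'.mag_ext_basis)
  qed simp_all
qed

context dup_algebra
begin

definition dot :: "'a \<Rightarrow> 'a \<Rightarrow> 'a" where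
  "dot x y = prec x y - succ x y"

lemma mag_algebra_dot: "mag_algebra scale dot"
  by unfold_locales
    (simp_all add: dot_def prec.mul_add_left prec.mul_add_right prec.mul_scale_left
      prec.mul_scale_right succ.mul_add_left succ.mul_add_right succ.mul_scale_left
      succ.mul_scale_right prec.scale_right_diff_distrib)

text \<open>Put u = x \<cdot> y. Then u \<succ> z + u \<cdot> z = u \<prec> z = x \<cdot> (y \<prec>
  z), and subtracting x \<cdot> (y \<cdot> z) leaves x \<cdot> (y \<succ> z). This is the identity
  from which \<open>letter_dot\<close> was built.\<close>

lemma dot_succ: "dot x (succ y z) = succ (dot x y) z + dot (dot x y) z - dot x (dot y z)"
  by (simp add: dot_def prec.mul_diff_left prec.mul_diff_right succ.mul_diff_left
      succ.mul_diff_right prec_prec succ_prec succ_succ)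

lemma dup_ext_gen: "dup_ext scale prec succ f (dup_gen v) = f v"
  by (simp add: dup_gen_def dup_ext_abs free_ext_def lin_ext_basis prec.vector_space_axioms)

lemma dup_hom_dup_ext:
  "dup_hom dup_scale dup_prec dup_succ scale prec succ (dup_ext scale prec succ f)"
proof -
  let ?e = "dup_ext scale prec succ f"
  let ?m = "\<lambda>b. case b of Prec \<Rightarrow> prec | Succ \<Rightarrow> succ"
  have add: "?e (x + y) = ?e x + ?e y" for x y
    using dup_ext_abs[of f "rep_dup x + rep_dup y"]
    by (simp add: plus_dup.abs_eq[symmetric] abs_rep_dup lin_ext_add prec.vector_space_axioms
        free_ext_def dup_ext_def)
  have sc: "?e (dup_scale c x) = scale c (?e x)" for c x
    using dup_ext_abs[of f "fscale c (rep_dup x)"]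
    by (simp add: dup_scale.abs_eq[symmetric] abs_rep_dup lin_ext_scale prec.vector_space_axioms
        free_ext_def dup_ext_def)
  have m: "mag_algebra scale (?m b)" for b
    by (auto split: dup_op.split intro: prec.mag_algebra_axioms succ.mag_algebra_axioms)
  have mult: "?e (dup_mult b x y) = ?m b (?e x) (?e y)" for b x y
    using dup_ext_abs[of f "graft b (rep_dup x) (rep_dup y)"]
    by (simp add: dup_mult.abs_eq[symmetric] abs_rep_dup free_ext_graft[OF m])
      (simp add: dup_ext_def)
  have "Vector_Spaces.linear dup_scale scale ?e"
    by unfold_locales (simp_all add: add sc)
  then show ?thesis
    using mult[of Prec] mult[of Succ] by (simp add: dup_hom_def mag_hom_def)
qed

end

lemma dup_hom_imp_mag_hom_dot:
  assumes "dup_algebra s p q" "dup_algebra s' p' q'" "dup_hom s p q s' p' q' h"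
  shows "mag_hom s (dup_algebra.dot p q) s' (dup_algebra.dot p' q') h"
proof -
  interpret d: dup_algebra s p q by fact
  interpret d': dup_algebra s' p' q' by fact
  from assms(3) have p: "mag_hom s p s' p' h" and q: "mag_hom s q s' q' h"
    by (simp_all add: dup_hom_def)
  from p have "Vector_Spaces.linear s s' h" by (simp add: mag_hom_def)
  moreover have "h (d.dot x y) = d'.dot (h x) (h y)" for x y
    by (simp add: d.dot_def d'.dot_def mag_hom_simps(3,5)[OF p] mag_hom_simps(5)[OF q])
  ultimately show ?thesis by (simp add: mag_hom_def)
qed

lemma dup_induct [case_names zero add scale gen mult]:
  assumes "P 0" "\<And>x y. P x \<Longrightarrow> P y \<Longrightarrow> P (x + y)" "\<And>c x. P x \<Longrightarrow> P (dup_scale c x)"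
    "\<And>v. P (dup_gen v)" "\<And>b x y. P x \<Longrightarrow> P y \<Longrightarrow> P (dup_mult b x y)"
  shows "P (x :: ('v, 'k::field) dup)"
proof -
  have "P (abs_dup p)" for p :: "(dup_op, 'v) bintree \<Rightarrow>\<^sub>0 'k"
  proof (induction p rule: free_induct)
    case (basis t)
    have node: "abs_dup (basis (Node b s t)) = dup_mult b (abs_dup (basis s)) (abs_dup (basis t))"
      for b and s t :: "(dup_op, 'v) bintree"
      by (simp add: dup_mult.abs_eq graft_basis)
    have leaf: "P (abs_dup (basis (Leaf v)))" for v
      using assms(4)[of v] by (simp add: dup_gen_def)
    show ?case
      by (induction t) (simp_all add: leaf node assms(5))
  qed (simp_all add: assms flip: zero_dup_def plus_dup.abs_eq dup_scale.abs_eq)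
  from this[of "rep_dup x"] show ?thesis by (simp add: abs_rep_dup)
qed

section \<open>The free duplicial algebra as the algebra of words\<close>

text \<open>This one map restricts to the operad isomorphism in all arities.\<close>

definition mag_to_dup :: "('v, 'k) mag \<Rightarrow> ('v, 'k::field) dup" where
  "mag_to_dup = mag_ext dup_scale dup.dot dup_gen"

definition dup_to_words :: "('v, 'k) dup \<Rightarrow> ('v, 'k::field) words" where
  "dup_to_words = dup_ext fscale word_prec word_succ (\<lambda>v. basis (Single (Leaf v)))"

text \<open>Reads a word as the iterated \<succ> product of the primitive elements named by its
  letters.\<close>

primrec word_to_dup :: "(unit, 'v) bintree word \<Rightarrow> ('v, 'k::field) dup" where
  "word_to_dup (Single t) = mag_to_dup (basis t)"
| "word_to_dup (Prepend t w) = dup_succ (mag_to_dup (basis t)) (word_to_dup w)"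

definition words_to_dup :: "('v, 'k) words \<Rightarrow> ('v, 'k::field) dup" where
  "words_to_dup = lin_ext dup_scale word_to_dup"

interpretation dot: mag_algebra dup_scale "dup.dot :: ('v, 'k) dup \<Rightarrow> ('v, 'k::field) dup \<Rightarrow> _"
  by (rule dup.mag_algebra_dot)

lemma mag_hom_mag_to_dup: "mag_hom fscale mag_mult dup_scale dup.dot mag_to_dup"
  unfolding mag_to_dup_def by (rule dot.mag_hom_mag_ext)

lemmas mag_to_dup_simps [simp] = mag_hom_simps[OF mag_hom_mag_to_dup]

lemma mag_to_dup_gen [simp]: "mag_to_dup (mag_gen v) = dup_gen v"
  by (simp add: mag_to_dup_def dot.mag_ext_gen)

lemma mag_to_dup_Leaf [simp]: "mag_to_dup (basis (Leaf v)) = dup_gen v"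
  using mag_to_dup_gen[of v] by (simp add: mag_gen_def)

lemma mag_to_dup_Node [simp]:
  "mag_to_dup (basis (Node b s t)) = dup.dot (mag_to_dup (basis s)) (mag_to_dup (basis t))"
  using mag_to_dup_simps(5)[of "basis s" "basis t"] by (simp add: graft_basis)

lemma dup_hom_dup_to_words:
  "dup_hom dup_scale dup_prec dup_succ fscale word_prec word_succ dup_to_words"
  unfolding dup_to_words_def by (rule words.dup_hom_dup_ext)

lemma mag_hom_dup_to_words:
  "mag_hom dup_scale dup_prec fscale word_prec dup_to_words"
  "mag_hom dup_scale dup_succ fscale word_succ dup_to_words"
  "mag_hom dup_scale dup.dot fscale words.dot dup_to_words"
  by (rule dup_hom_dup_to_words[unfolded dup_hom_def, THEN conjunct1]
      dup_hom_dup_to_words[unfolded dup_hom_def, THEN conjunct2]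
      dup_hom_imp_mag_hom_dot[OF dup.dup_algebra_axioms words.dup_algebra_axioms
        dup_hom_dup_to_words])+

lemmas dup_to_words_simps [simp] = mag_hom_simps[OF mag_hom_dup_to_words(1)]
  mag_hom_simps(5)[OF mag_hom_dup_to_words(2)] mag_hom_simps(5)[OF mag_hom_dup_to_words(3)]

lemma dup_to_words_gen [simp]: "dup_to_words (dup_gen v) = basis (Single (Leaf v))"
  by (simp add: dup_to_words_def words.dup_ext_gen)

lemma words_dot_Single: "words.dot (basis (Single a)) p = word_dot a p"
  by (simp add: words.dot_def word_prec_Single word_succ_Single)

text \<open>The product of two letters in the model is the grafted letter, so a whole magmatic tree
  becomes one letter. Injectivity of \<open>mag_to_dup\<close> rests on this.\<close>

lemma dup_to_words_mag_to_dup_basis: "dup_to_words (mag_to_dup (basis t)) = basis (Single t)"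
  by (induction t) (simp_all add: words_dot_Single letter_dot_Single)

lemma dup_to_words_mag_to_dup:
  "dup_to_words (mag_to_dup p) = lin_ext fscale (\<lambda>t. basis (Single t)) p"
  by (induction p rule: free_induct) (simp_all add: dup_to_words_mag_to_dup_basis)

lemma linear_words_to_dup: "Vector_Spaces.linear fscale dup_scale words_to_dup"
  unfolding words_to_dup_def by (rule linear_lin_ext) (rule dup.vector_space_axioms)

interpretation words_to_dup: Vector_Spaces.linear fscale dup_scale
  "words_to_dup :: ('v, 'k::field) words \<Rightarrow> _"
  by (rule linear_words_to_dup)

lemmas words_to_dup_simps [simp] = words_to_dup.zero words_to_dup.add words_to_dup.diff
  words_to_dup.scale

lemma words_to_dup_basis [simp]: "words_to_dup (basis w) = word_to_dup w"
  by (simp add: words_to_dup_def lin_ext_basis dup.vector_space_axioms)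

lemmas dup_linear = dup.mul_add_left dup.mul_add_right dup.mul_scale_left dup.mul_scale_right
  dup.mul_diff_left dup.mul_diff_right

lemmas dot_linear = dot.mul_add_left dot.mul_add_right dot.mul_scale_left dot.mul_scale_right
  dot.mul_diff_left dot.mul_diff_right

lemma words_to_dup_prepend:
  "words_to_dup (prepend a p) = dup_succ (mag_to_dup (basis a)) (words_to_dup p)"
  by (induction p rule: free_induct) (simp_all add: dup_linear, simp add: prepend_def)

text \<open>The recursion for \<open>letter_dot\<close> is an instance of \<open>dot_succ\<close>,
  which also holds in Dup(V); hence both sides satisfy the same recursion on length.\<close>

lemma words_to_dup_letter_dot:
  "words_to_dup (letter_dot a w :: ('v, 'k::field) words)
    = dup.dot (mag_to_dup (basis a)) (word_to_dup w)"
proof (induction "size w" arbitrary: a w rule: less_induct)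
  case less
  show ?case
  proof (cases w)
    case (Single b)
    then show ?thesis by (simp add: letter_dot_Single)
  next
    case (Prepend b u)
    have IH: "words_to_dup (letter_dot c v :: ('v, 'k) words)
        = dup.dot (mag_to_dup (basis c)) (word_to_dup v)" if "size v \<le> size u" for c v
      using that Prepend by (intro less.hyps) simp
    have "words_to_dup (word_dot a (letter_dot b u :: ('v, 'k) words))
        = dup.dot (mag_to_dup (basis a)) (words_to_dup (letter_dot b u))"
    proof (rule linear_eq_on_keys[where f = "\<lambda>p. words_to_dup (word_dot a p)"
          and g = "\<lambda>p. dup.dot (mag_to_dup (basis a)) (words_to_dup p)"])
      show "Vector_Spaces.linear fscale dup_scale (\<lambda>p :: ('v, 'k) words. words_to_dup (word_dot a p))"
        by unfold_locales simp_all
      show "Vector_Spaces.linear fscale dup_scale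
          (\<lambda>p :: ('v, 'k) words. dup.dot (mag_to_dup (basis a)) (words_to_dup p))"
        by unfold_locales (simp_all add: dot_linear)
      fix v assume "v \<in> Poly_Mapping.keys (letter_dot b u :: ('v, 'k) words)"
      from IH[OF keys_letter_dot_size[OF this]]
      show "words_to_dup (word_dot a (basis v) :: ('v, 'k) words)
          = dup.dot (mag_to_dup (basis a)) (words_to_dup (basis v))"
        by simp
    qed
    then show ?thesis
      by (simp add: Prepend letter_dot_Prepend IH dup.dot_succ)
  qed
qed

lemma words_to_dup_word_dot:
  "words_to_dup (word_dot a p) = dup.dot (mag_to_dup (basis a)) (words_to_dup p)"
  by (induction p rule: free_induct) (simp_all add: dot_linear words_to_dup_letter_dot)

lemma words_to_dup_succ:
  "words_to_dup (word_succ p q) = dup_succ (words_to_dup p) (words_to_dup q)"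
proof (induction p rule: free_induct)
  case (basis u)
  show ?case
    by (induction u)
      (simp_all only: word_succ_Single words_to_dup_prepend words_to_dup_basis word_to_dup.simps
        basis_Prepend word_succ_prepend dup.succ_succ)
qed (simp_all add: word_succ_linear dup_linear)

lemma words_to_dup_prec:
  "words_to_dup (word_prec p q) = dup_prec (words_to_dup p) (words_to_dup q)"
proof (induction p rule: free_induct)
  case (basis u)
  show ?case
  proof (induction u)
    case (Single a)
    show ?case
      by (simp add: word_prec_Single words_to_dup_prepend words_to_dup_word_dot dup.dot_def)
  next
    case (Prepend a u)
    then show ?case
      by (simp only: words_to_dup_prepend words_to_dup_basis word_to_dup.simps
          basis_Prepend word_prec_prepend dup.succ_prec)
  qed
qed (simp_all add: word_prec_linear dup_linear)

text \<open>The composite respects both operations and fixes the generators. Every element of Dup(V)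
  is therefore a combination of images of words, on which the coproduct can be computed.\<close>

lemma words_to_dup_inverse: "words_to_dup (dup_to_words x) = x"
proof (induction x rule: dup_induct)
  case (mult b x y)
  then show ?case by (cases b) (simp_all add: words_to_dup_prec words_to_dup_succ)
qed simp_all

section \<open>Primitive elements\<close>

text \<open>Universal property of the tensor square for an arbitrary target space; independence of
  the representative is \<open>tensor_lift_abs\<close>.\<close>

definition tensor_lift :: "('k::field \<Rightarrow> 'a \<Rightarrow> 'a::ab_group_add)
    \<Rightarrow> (('v, 'k) dup \<Rightarrow> ('v, 'k) dup \<Rightarrow> 'a) \<Rightarrow> ('v, 'k) dup_tensor \<Rightarrow> 'a" where
  "tensor_lift s \<beta> z = lin_ext s (\<lambda>(x, y). \<beta> x y) (rep_dup_tensor z)"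

context
  fixes s :: "'k::field \<Rightarrow> 'a \<Rightarrow> 'a::ab_group_add" and \<beta> :: "('v, 'k) dup \<Rightarrow> ('v, 'k) dup \<Rightarrow> 'a"
  assumes left: "\<And>y. Vector_Spaces.linear dup_scale s (\<lambda>x. \<beta> x y)"
    and right: "\<And>x. Vector_Spaces.linear dup_scale s (\<beta> x)"
begin

lemma tensor_lift_abs: "tensor_lift s \<beta> (abs_dup_tensor p) = lin_ext s (\<lambda>(x, y). \<beta> x y) p"
proof -
  let ?e = "lin_ext s (\<lambda>(x, y). \<beta> x y)"
  interpret f: Vector_Spaces.linear dup_scale s "\<lambda>x. \<beta> x y" for y by (rule left)
  interpret g: Vector_Spaces.linear dup_scale s "\<beta> x" for x by (rule right)
  interpret l: Vector_Spaces.linear fscale s ?e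
    by (rule linear_lin_ext) (rule f.vs2.vector_space_axioms)
  have "?e q = 0" if "q \<in> fvs.span (bilinear_relations dup_scale dup_scale)" for q
    using that
  proof (induction rule: fvs.span_induct_alt)
    case (step c x y)
    then show ?case
      by (auto simp: bilinear_relations_def l.add l.scale l.diff lin_ext_basis
          f.vs2.vector_space_axioms f.add g.add f.scale g.scale)
  qed (rule l.zero)
  moreover have "rep_dup_tensor (abs_dup_tensor p) - p
      \<in> fvs.span (bilinear_relations dup_scale dup_scale)"
    using Quotient3_rep_abs[OF Quotient3_dup_tensor, of p] by (simp add: fvs.span_zero)
  ultimately have "?e (rep_dup_tensor (abs_dup_tensor p) - p) = 0" by blast
  then show ?thesis by (simp add: tensor_lift_def l.diff)
qed

lemma tensor_lift_tensor: "tensor_lift s \<beta> (x \<otimes> y) = \<beta> x y"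
proof -
  interpret f: Vector_Spaces.linear dup_scale s "\<lambda>x. \<beta> x y" by (rule left)
  show ?thesis
    using tensor_lift_abs[of "basis (x, y)"]
    by (simp add: tensor_def lin_ext_basis f.vs2.vector_space_axioms)
qed

lemma linear_tensor_lift: "Vector_Spaces.linear tensor_scale s (tensor_lift s \<beta>)"
proof -
  interpret f: Vector_Spaces.linear dup_scale s "\<lambda>x. \<beta> x 0" by (rule left)
  have add: "tensor_lift s \<beta> (w + z) = tensor_lift s \<beta> w + tensor_lift s \<beta> z" for w z
    using tensor_lift_abs[of "rep_dup_tensor w + rep_dup_tensor z"]
    by (simp add: plus_dup_tensor.abs_eq[symmetric] abs_rep_tensor lin_ext_add
        f.vs2.vector_space_axioms tensor_lift_def)
  have "tensor_lift s \<beta> (tensor_scale c z) = s c (tensor_lift s \<beta> z)" for c z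
    using tensor_lift_abs[of "fscale c (rep_dup_tensor z)"]
    by (simp add: tensor_scale.abs_eq[symmetric] abs_rep_tensor lin_ext_scale
        f.vs2.vector_space_axioms tensor_lift_def)
  with add show ?thesis by unfold_locales
qed

end

section \<open>The kernel of the coproduct\<close>

interpretation dup_delta: Vector_Spaces.linear dup_scale tensor_scale
  "dup_delta :: ('v, 'k::field) dup \<Rightarrow> _"
  by (rule linear_dup_delta)

text \<open>For primitive x and y both x \<prec> y and x \<succ> y have coproduct
  \<open>x \<otimes> y\<close>, so the difference is primitive.\<close>

lemma dup_delta_dot:
  assumes "dup_delta x = 0" "dup_delta y = 0"
  shows "dup_delta (dup.dot x y) = 0"
  using assms by (simp add: dup.dot_def dup_delta.diff dup_delta_mult)

lemma dup_delta_mag_to_dup [simp]: "dup_delta (mag_to_dup p) = 0"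
proof (induction p rule: free_induct)
  case (basis t)
  show ?case by (induction t) (simp_all add: dup_delta_gen dup_delta_dot)
qed (simp_all add: dup_delta.add dup_delta.scale)

definition letter_part :: "('v, 'k) words \<Rightarrow> ('v, 'k::field) mag" where
  "letter_part = lin_ext fscale (\<lambda>w. case w of Single t \<Rightarrow> basis t | Prepend t u \<Rightarrow> 0)"

lemma letter_part_simps [simp]:
  "letter_part 0 = 0"
  "letter_part (p + q) = letter_part p + letter_part q"
  "letter_part (fscale c p) = fscale c (letter_part p)"
  "letter_part (basis (Single t)) = basis t"
  "letter_part (basis (Prepend t w)) = 0"
  by (simp_all add: letter_part_def)

lemma letter_part_prepend [simp]: "letter_part (prepend a p) = 0"
  by (induction p rule: free_induct) (simp_all flip: basis_Prepend)

text \<open>On words, \<open>\<delta>\<close> is deconcatenation. Composing it with the projection of the left factor onto the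
  letters and with concatenation gives the identity on words of length at least two.\<close>

lemma dup_primitive_eq:
  fixes x :: "('v, 'k::field) dup"
  assumes "dup_delta x = 0"
  shows "mag_to_dup (letter_part (dup_to_words x)) = x"
proof -
  let ?\<beta> = "\<lambda>x y :: ('v, 'k) dup. dup_succ (mag_to_dup (letter_part (dup_to_words x))) y"
  let ?T = "tensor_lift dup_scale ?\<beta>"
  have left: "Vector_Spaces.linear dup_scale dup_scale (\<lambda>x. ?\<beta> x y)" for y
    by unfold_locales (simp_all add: dup_linear)
  have right: "Vector_Spaces.linear dup_scale dup_scale (?\<beta> x)" for x
    by unfold_locales (simp_all add: dup_linear)
  note T_tensor = tensor_lift_tensor[of dup_scale ?\<beta>, OF left right]
  interpret T: Vector_Spaces.linear tensor_scale dup_scale ?T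
    by (rule linear_tensor_lift[of dup_scale ?\<beta>, OF left right])
  \<comment> \<open>In these terms the left factor has the form t \<succ> x, a combination of words
    of length at least two, which the letter projection kills.\<close>
  have act: "?T (act_left Succ (mag_to_dup (basis t)) z) = 0" for t z
    by (induction z rule: tensor_induct)
      (simp_all add: T.zero T.add T.scale T_tensor dup_to_words_mag_to_dup_basis word_succ_Single)
  \<comment> \<open>For a letter both sides vanish. For a \<succ> u the coproduct is a \<otimes> u
    plus terms killed by \<open>act\<close>, so \<open>?T\<close> returns a \<succ> u, while the
    letter part is 0.\<close>
  have word: "?T (dup_delta (words_to_dup p)) = words_to_dup p - mag_to_dup (letter_part p)" for p
  proof (induction p rule: free_induct)
    case (basis w)
    show ?case
      by (cases w)
        (simp_all add: T.zero T.add dup_delta_mult act T_tensor dup_to_words_mag_to_dup_basis)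
  qed (simp_all add: T.zero T.add T.scale dup_delta.zero dup_delta.add dup_delta.scale
      dup.scale_right_diff_distrib)
  from word[of "dup_to_words x"] show ?thesis
    using assms by (simp add: words_to_dup_inverse T.zero)
qed

text \<open>A left inverse passes through the model, where trees become letters and
  \<open>letter_part\<close> reads them back.\<close>

lemma inj_mag_to_dup: "inj mag_to_dup"
proof (rule inj_on_inverseI)
  fix p :: "('a, 'b) mag"
  show "letter_part (dup_to_words (mag_to_dup p)) = p"
    unfolding dup_to_words_mag_to_dup by (induction p rule: free_induct) simp_all
qed

section \<open>Grading by leaves\<close>

text \<open>The multiset form is additive under grafting, so multilinearity becomes a homogeneity
  condition.\<close>

lemma multilinear_trees_iff: "t \<in> multilinear_trees n \<longleftrightarrow> mset (leaves t) = mset_set {..<n}"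
proof
  assume "t \<in> multilinear_trees n"
  then show "mset (leaves t) = mset_set {..<n}"
    using mset_set_set[of "leaves t"] by (simp add: multilinear_trees_def)
next
  assume *: "mset (leaves t) = mset_set {..<n}"
  then have set: "set (leaves t) = {..<n}"
    by (metis finite_lessThan finite_set_mset_mset_set set_mset_mset)
  then have "distinct (leaves t)"
    by (simp add: distinct_count_atmost_1 * count_mset_set')
  with set show "t \<in> multilinear_trees n" by (simp add: multilinear_trees_def)
qed

lemma keys_bilin_ext_subset:
  assumes "\<And>a b. a \<in> Poly_Mapping.keys p \<Longrightarrow> b \<in> Poly_Mapping.keys q \<Longrightarrow>
    Poly_Mapping.keys (f a b) \<subseteq> S"
  shows "Poly_Mapping.keys (bilin_ext f p q) \<subseteq> S"
  unfolding bilin_ext_def using assms by (intro keys_lin_ext_subset)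

lemma keys_word_mult_prec:
  "Poly_Mapping.keys (word_mult_prec u w :: ('v, 'k::field) words)
    \<subseteq> {v. word_leaves v = word_leaves u + word_leaves w}"
proof (induction u)
  case (Single a)
  show ?case
    unfolding word_mult_prec.simps letter_dot_def
    by (intro keys_add_subset order.trans[OF keys_letter_dot_depth_leaves]) simp_all
next
  case (Prepend a u)
  then show ?case
    unfolding word_mult_prec.simps prepend_def by (intro keys_lin_ext_subset) auto
qed

lemma keys_word_prec:
  assumes "Poly_Mapping.keys p \<subseteq> {w. word_leaves w = M}" "Poly_Mapping.keys q \<subseteq> {w. word_leaves w = N}"
  shows "Poly_Mapping.keys (word_prec p q) \<subseteq> {w. word_leaves w = M + N}"
  unfolding word_prec_def
proof (rule keys_bilin_ext_subset)
  fix u w assume "u \<in> Poly_Mapping.keys p" "w \<in> Poly_Mapping.keys q"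
  then have "M = word_leaves u" "N = word_leaves w" using assms by auto
  then show "Poly_Mapping.keys (word_mult_prec u w) \<subseteq> {w. word_leaves w = M + N}"
    by (simp only: keys_word_mult_prec)
qed

lemma keys_word_succ:
  assumes "Poly_Mapping.keys p \<subseteq> {w. word_leaves w = M}" "Poly_Mapping.keys q \<subseteq> {w. word_leaves w = N}"
  shows "Poly_Mapping.keys (word_succ p q) \<subseteq> {w. word_leaves w = M + N}"
  unfolding word_succ_def
  by (rule keys_bilin_ext_subset) (use assms in \<open>auto simp: word_leaves_append\<close>)

lemma abs_dup_Node:
  "abs_dup (basis (Node b s t)) = dup_mult b (abs_dup (basis s)) (abs_dup (basis t))"
  by (simp add: dup_mult.abs_eq graft_basis)

lemma keys_dup_to_words_basis:
  "Poly_Mapping.keys (dup_to_words (abs_dup (basis t)) :: ('v, 'k::field) words)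
    \<subseteq> {w. word_leaves w = mset (leaves t)}"
proof (induction t)
  case (Leaf v)
  have "abs_dup (basis (Leaf v)) = (dup_gen v :: ('v, 'k) dup)" by (simp add: dup_gen_def)
  then show ?case by simp
next
  case (Node b s t)
  then show ?case
    by (cases b) (simp_all only: abs_dup_Node dup_to_words_simps leaves.simps mset_append
        keys_word_prec keys_word_succ)
qed

lemma keys_letter_part:
  fixes p :: "('v, 'k::field) words"
  assumes "Poly_Mapping.keys p \<subseteq> {w. word_leaves w = M}"
  shows "Poly_Mapping.keys (letter_part p) \<subseteq> {t. mset (leaves t) = M}"
  unfolding letter_part_def
proof (rule keys_lin_ext_subset)
  fix w assume "w \<in> Poly_Mapping.keys p"
  with assms have "word_leaves w = M" by auto
  then show "Poly_Mapping.keys ((case w of Single t \<Rightarrow> basis t | Prepend t u \<Rightarrow> 0) :: ('v, 'k) mag)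
      \<subseteq> {t. mset (leaves t) = M}"
    by (cases w) simp_all
qed

text \<open>Elements of the quotient have no support, so here the grading is expressed by spans of
  monomials. Both operations keep the order of the leaves, which allows lists in place of
  multisets.\<close>

lemma dup_mult_span:
  assumes "x \<in> dup.span ((\<lambda>s. abs_dup (basis s)) ` {s. leaves s = l})"
    "y \<in> dup.span ((\<lambda>s. abs_dup (basis s)) ` {s. leaves s = l'})"
  shows "dup_mult b x y \<in> dup.span ((\<lambda>s. abs_dup (basis s)) ` {s. leaves s = l @ l'})"
    (is "_ \<in> dup.span ?S")
  using assms(1)
proof (induction rule: dup.span_induct_alt)
  case base
  then show ?case by (simp add: dup.span_zero)
next
  case (step c x x')
  then obtain s where s: "x = abs_dup (basis s)" "leaves s = l" by auto
  have "dup_mult b x y \<in> dup.span ?S"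
    using assms(2)
  proof (induction rule: dup.span_induct_alt)
    case (step d z z')
    then obtain t where t: "z = abs_dup (basis t)" "leaves t = l'" by auto
    then have "dup_mult b x z \<in> ?S"
      using s by (auto simp: abs_dup_Node[symmetric] intro!: imageI)
    with step show ?case
      by (simp add: dup_linear dup.span_add dup.span_scale dup.span_base)
  qed (simp add: dup.span_zero)
  with step show ?case
    by (simp add: dup_linear dup.span_add dup.span_scale)
qed

lemma mag_to_dup_basis_span:
  "mag_to_dup (basis t) \<in> dup.span ((\<lambda>s. abs_dup (basis s)) ` {s. leaves s = leaves t})"
proof (induction t)
  case (Leaf v)
  have "dup_gen v = abs_dup (basis (Leaf v))" by (simp add: dup_gen_def)
  then show ?case by (auto intro!: dup.span_base)
next
  case (Node b s t)
  then show ?case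
    by (simp add: dup.dot_def dup_mult_span dup.span_diff)
qed

lemma keys_graft:
  assumes "Poly_Mapping.keys p \<subseteq> {t. mset (leaves t) = M}" "Poly_Mapping.keys q \<subseteq> {t. mset (leaves t) = N}"
  shows "Poly_Mapping.keys (graft b p q) \<subseteq> {t. mset (leaves t) = M + N}"
  unfolding graft_def
  by (intro keys_lin_ext_subset) (use assms in auto)

text \<open>Substitution adds up the leaf multisets of the inserted elements. Renumbering inputs is
  the case of singletons \<open>M i\<close>; operadic composition is the case of blocks.\<close>

lemma keys_mag_ext:
  assumes "Poly_Mapping.keys \<mu> \<subseteq> {t. mset (leaves t) = A}"
    and "\<And>i. i \<in># A \<Longrightarrow> Poly_Mapping.keys (f i) \<subseteq> {t. mset (leaves t) = M i}"
  shows "Poly_Mapping.keys (mag_ext fscale mag_mult f \<mu>) \<subseteq> {t. mset (leaves t) = (\<Sum>i\<in>#A. M i)}"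
proof -
  have *: "Poly_Mapping.keys (tree_eval (\<lambda>_. mag_mult) f t)
      \<subseteq> {s. mset (leaves s) = (\<Sum>i\<in>#mset (leaves t). M i)}"
    if "\<And>i. i \<in> set (leaves t) \<Longrightarrow> Poly_Mapping.keys (f i) \<subseteq> {t. mset (leaves t) = M i}"
    for t :: "(unit, 'a) bintree"
    using that
  proof (induction t)
    case (Node b s t)
    then show ?case
      by (simp only: tree_eval.simps leaves.simps mset_append image_mset_union sum_mset.union)
        (intro keys_graft; simp)
  qed simp
  show ?thesis
    unfolding mag_ext_def free_ext_def
  proof (rule keys_lin_ext_subset)
    fix t assume "t \<in> Poly_Mapping.keys \<mu>"
    with assms(1) have "A = mset (leaves t)" by auto
    then show "Poly_Mapping.keys (tree_eval (\<lambda>_. mag_mult) f t)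
        \<subseteq> {t. mset (leaves t) = (\<Sum>i\<in>#A. M i)}"
      using * assms(2) by simp
  qed
qed

section \<open>The operads\<close>

lemma mag_operad_simps [simp]:
  "op_scale mag_operad = fscale"
  "op_id mag_operad = mag_gen 0"
  "op_comp mag_operad ks \<mu> \<nu>s = mag_ext fscale mag_mult (\<lambda>i. mag_ext fscale mag_mult
     (\<lambda>j. mag_gen (j + sum_list (take i ks))) (\<nu>s ! i)) \<mu>"
  "op_act mag_operad \<mu> \<sigma> = mag_ext fscale mag_mult (\<lambda>i. mag_gen (inv \<sigma> i)) \<mu>"
  by (simp_all add: mag_operad_def subst_operad_def)

lemma mag_operations:
  "\<mu> \<in> operations mag_operad n \<longleftrightarrow> Poly_Mapping.keys \<mu> \<subseteq> {t. mset (leaves t) = mset_set {..<n}}"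
  by (auto simp: mag_operad_def subst_operad_def span_basis multilinear_trees_iff)

lemma mag_gen_operation: "mag_gen 0 \<in> operations mag_operad 1"
  by (simp add: mag_operations mag_gen_def lessThan_Suc)

lemma mag_act_operation:
  assumes "\<mu> \<in> operations mag_operad n" "\<sigma> permutes {..<n}"
  shows "op_act mag_operad \<mu> \<sigma> \<in> operations mag_operad n"
proof -
  from assms(2) have "inv \<sigma> permutes {..<n}" by (rule permutes_inv)
  then have "image_mset (inv \<sigma>) (mset_set {..<n}) = mset_set {..<n}"
    by (simp add: image_mset_mset_set permutes_inj_on permutes_image)
  then have "(\<Sum>i\<in>#mset_set {..<n}. {#inv \<sigma> i#}) = mset_set {..<n}"
    by simp
  with keys_mag_ext[of \<mu> "mset_set {..<n}" "\<lambda>i. mag_gen (inv \<sigma> i)" "\<lambda>i. {#inv \<sigma> i#}"] assms(1)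
  show ?thesis by (simp add: mag_operations mag_gen_def)
qed

lemma mag_comp_operation:
  assumes "composable mag_operad ks \<mu> \<nu>s"
  shows "op_comp mag_operad ks \<mu> \<nu>s \<in> operations mag_operad (sum_list ks)"
proof -
  let ?S = "\<lambda>i. sum_list (take i ks)"
  let ?\<nu> = "\<lambda>i. mag_ext fscale mag_mult (\<lambda>j. mag_gen (j + ?S i)) (\<nu>s ! i)"
  \<comment> \<open>After the shift, the i-th inserted operation uses exactly the variables of the
    i-th block.\<close>
  have \<nu>: "Poly_Mapping.keys (?\<nu> i) \<subseteq> {t. mset (leaves t) = mset_set {?S i..<?S i + ks ! i}}"
    if "i < length ks" for i
  proof -
    have "image_mset (\<lambda>j. j + ?S i) (mset_set {..<ks ! i}) = mset_set {?S i..<?S i + ks ! i}"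
      by (simp add: image_mset_mset_set inj_on_def lessThan_atLeast0 add.commute)
    moreover have "Poly_Mapping.keys (\<nu>s ! i) \<subseteq> {t. mset (leaves t) = mset_set {..<ks ! i}}"
      using assms that by (simp add: composable_def mag_operations)
    ultimately show ?thesis
      using keys_mag_ext[of "\<nu>s ! i" "mset_set {..<ks ! i}" "\<lambda>j. mag_gen (j + ?S i)"
          "\<lambda>j. {#j + ?S i#}"]
      by (simp add: mag_gen_def)
  qed
  \<comment> \<open>The blocks are consecutive intervals and together fill an initial
    segment.\<close>
  have blocks: "(\<Sum>i\<in>#mset_set {..<m}. mset_set {?S i..<?S i + ks ! i}) = mset_set {..<?S m}"
    if "m \<le> length ks" for m
    using that
  proof (induction m)
    case (Suc m)
    then have *: "?S (Suc m) = ?S m + ks ! m" by (simp add: take_Suc_conv_app_nth)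
    have "mset_set {..<?S m + ks ! m} = mset_set {..<?S m} + mset_set {?S m..<?S m + ks ! m}"
      by (subst mset_set_Union[symmetric]) (auto simp: ivl_disj_un)
    with Suc * show ?case by (simp add: lessThan_Suc add.commute)
  qed simp
  have "Poly_Mapping.keys (mag_ext fscale mag_mult ?\<nu> \<mu>) \<subseteq> {t. mset (leaves t) =
      (\<Sum>i\<in>#mset_set {..<length ks}. mset_set {?S i..<?S i + ks ! i})}"
    by (rule keys_mag_ext) (use assms \<nu> in \<open>auto simp: composable_def mag_operations\<close>)
  then show ?thesis using blocks[of "length ks"] by (simp add: mag_operations)
qed

section \<open>The duplicial operad and its primitive part\<close>

lemma dup_operad_simps [simp]:
  "op_scale dup_operad = dup_scale"
  "op_id dup_operad = dup_gen 0"
  "op_comp dup_operad ks \<mu> \<nu>s = dup_ext dup_scale dup_prec dup_succ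
     (\<lambda>i. dup_ext dup_scale dup_prec dup_succ
       (\<lambda>j. dup_gen (j + sum_list (take i ks))) (\<nu>s ! i)) \<mu>"
  "op_act dup_operad \<mu> \<sigma> = dup_ext dup_scale dup_prec dup_succ (\<lambda>i. dup_gen (inv \<sigma> i)) \<mu>"
  by (simp_all add: dup_operad_def subst_operad_def)

lemma prim_dup_operad_simps [simp]:
  "op_scale prim_dup_operad = op_scale dup_operad"
  "op_id prim_dup_operad = op_id dup_operad"
  "op_comp prim_dup_operad = op_comp dup_operad"
  "op_act prim_dup_operad = op_act dup_operad"
  by (simp_all add: prim_dup_operad_def)

lemma dup_operations:
  "operations dup_operad n = dup.span ((\<lambda>t. abs_dup (basis t)) ` multilinear_trees n)"
  by (simp add: dup_operad_def subst_operad_def)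

lemma keys_dup_to_words:
  fixes x :: "(nat, 'k::field) dup"
  assumes "x \<in> operations dup_operad n"
  shows "Poly_Mapping.keys (dup_to_words x) \<subseteq> {w. word_leaves w = mset_set {..<n}}"
  using assms unfolding dup_operations
proof (induction rule: dup.span_induct_alt)
  case (step c x y)
  then obtain t where "x = abs_dup (basis t)" "mset (leaves t) = mset_set {..<n}"
    by (auto simp: multilinear_trees_iff)
  with keys_dup_to_words_basis[of t, where 'k = 'k] step show ?case
    by (simp only: dup_to_words_simps)
      (intro keys_add_subset order.trans[OF keys_fscale_subset]; simp)
qed simp

text \<open>A primitive operation is recovered from its letter part, which inherits multilinearity
  from the grading of words. Conversely, images of trees are primitive, and they are combinations of
  monomials with the same leaves.\<close>

lemma prim_dup_operations:
  "operations (prim_dup_operad :: ('k::field, (nat, 'k) dup) operad) n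
    = mag_to_dup ` operations mag_operad n"
proof (intro equalityI subsetI)
  fix x :: "(nat, 'k) dup"
  assume "x \<in> operations prim_dup_operad n"
  then have "x \<in> operations dup_operad n" "dup_delta x = 0"
    by (simp_all add: prim_dup_operad_def)
  then show "x \<in> mag_to_dup ` operations mag_operad n"
    using dup_primitive_eq[of x] keys_letter_part[OF keys_dup_to_words[of x n]]
    by (metis image_eqI mag_operations)
next
  fix x :: "(nat, 'k) dup"
  assume "x \<in> mag_to_dup ` operations mag_operad n"
  then obtain \<mu> where x: "x = mag_to_dup \<mu>" and "\<mu> \<in> fvs.span (basis ` multilinear_trees n)"
    by (auto simp: mag_operad_def subst_operad_def)
  from this(2) have "mag_to_dup \<mu> \<in> operations dup_operad n"
    unfolding dup_operations
  proof (induction rule: fvs.span_induct_alt)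
    case (step c y z)
    then obtain t where t: "y = basis t" "t \<in> multilinear_trees n" by auto
    then have "(\<lambda>s. abs_dup (basis s) :: (nat, 'k) dup) ` {s. leaves s = leaves t}
        \<subseteq> (\<lambda>t. abs_dup (basis t)) ` multilinear_trees n"
      by (auto simp: multilinear_trees_def)
    with mag_to_dup_basis_span[of t] dup.span_mono
    have "mag_to_dup y \<in> dup.span ((\<lambda>t. abs_dup (basis t)) ` multilinear_trees n)"
      unfolding t by blast
    with step show ?case by (simp add: dup.span_add dup.span_scale)
  qed (simp add: dup.span_zero)
  then show "x \<in> operations prim_dup_operad n"
    by (simp add: prim_dup_operad_def x)
qed

text \<open>This is the functor F on operations: evaluating the image of a magmatic operation in a
  duplicial algebra is evaluating that operation with \<cdot>. A duplicial morphism is also a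
  morphism for \<cdot>, so uniqueness of extensions applies.\<close>

lemma (in dup_algebra) dup_ext_mag_to_dup:
  "dup_ext scale prec succ f (mag_to_dup \<mu>) = mag_ext scale dot f \<mu>"
  unfolding mag_to_dup_def
  by (subst mag_hom_mag_ext_comp[OF dup.mag_algebra_dot mag_algebra_dot
        dup_hom_imp_mag_hom_dot[OF dup.dup_algebra_axioms dup_algebra_axioms dup_hom_dup_ext]])
    (simp add: dup_ext_gen)

text \<open>Compatibility with substitution handles composition and permutation of inputs at once,
  both being defined by substitution.\<close>

lemma mag_to_dup_mag_ext:
  "mag_to_dup (mag_ext fscale mag_mult f \<mu>)
    = dup_ext dup_scale dup_prec dup_succ (\<lambda>i. mag_to_dup (f i)) (mag_to_dup \<mu>)"
  by (simp add: dup.dup_ext_mag_to_dup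
      mag_hom_mag_ext_comp[OF graft.mag_algebra_axioms dup.mag_algebra_dot mag_hom_mag_to_dup])

lemma mag_to_dup_comp:
  assumes "composable mag_operad ks \<mu> \<nu>s"
  shows "mag_to_dup (op_comp mag_operad ks \<mu> \<nu>s)
    = op_comp dup_operad ks (mag_to_dup \<mu>) (map mag_to_dup \<nu>s)"
proof -
  from assms have "\<mu> \<in> operations mag_operad (length ks)" "length \<nu>s = length ks"
    by (simp_all add: composable_def)
  \<comment> \<open>The leaf labels of an operation of arity \<open>length ks\<close> are valid
    indices, which is what \<open>map\<close> and \<open>!\<close> need to commute.\<close>
  then have nth: "map mag_to_dup \<nu>s ! i = mag_to_dup (\<nu>s ! i)"
    if "t \<in> Poly_Mapping.keys \<mu>" "i \<in> set (leaves t)" for t i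
  proof -
    from that(1) \<open>\<mu> \<in> _\<close> have t: "mset (leaves t) = mset_set {..<length ks}"
      by (auto simp: mag_operations)
    from that(2) have "i \<in># mset_set {..<length ks}" by (simp flip: t)
    with \<open>length \<nu>s = _\<close> show ?thesis by simp
  qed
  show ?thesis
    unfolding mag_operad_simps dup_operad_simps mag_to_dup_mag_ext mag_to_dup_gen
      dup.dup_ext_mag_to_dup
    by (rule dot.mag_ext_cong) (simp only: nth dup.dup_ext_mag_to_dup)
qed

lemma mag_to_dup_act: "mag_to_dup (op_act mag_operad \<mu> \<sigma>) = op_act dup_operad (mag_to_dup \<mu>) \<sigma>"
  by (simp add: mag_to_dup_mag_ext)

lemma composable_prim_obtains:
  assumes "composable (prim_dup_operad :: ('k::field, (nat, 'k) dup) operad) ks \<mu> \<nu>s"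
  obtains \<mu>' \<nu>s' where "composable mag_operad ks \<mu>' \<nu>s'" "\<mu> = mag_to_dup \<mu>'"
    "\<nu>s = map mag_to_dup \<nu>s'"
proof -
  from assms obtain \<mu>' where \<mu>': "\<mu>' \<in> operations mag_operad (length ks)" "\<mu> = mag_to_dup \<mu>'"
    by (auto simp: composable_def prim_dup_operations)
  from assms have "\<forall>i<length ks. \<exists>\<nu>. \<nu> \<in> operations mag_operad (ks ! i) \<and> \<nu>s ! i = mag_to_dup \<nu>"
    by (auto simp: composable_def prim_dup_operations)
  then obtain g where g: "\<And>i. i < length ks \<Longrightarrow>
      g i \<in> operations mag_operad (ks ! i) \<and> \<nu>s ! i = mag_to_dup (g i)"
    by metis
  show ?thesis
  proof (rule that)
    show "composable mag_operad ks \<mu>' (map g [0..<length ks])"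
      using \<mu>' g by (simp add: composable_def)
    show "\<nu>s = map mag_to_dup (map g [0..<length ks])"
      using assms g by (auto simp: composable_def intro!: nth_equalityI)
  qed (rule \<mu>'(2))
qed

text \<open>Closure under composition and permutations requires no coproduct of a composite: the
  data are pulled back along \<open>mag_to_dup\<close>, where Mag is already closed.\<close>

lemma suboperad_prim_dup: "suboperad (prim_dup_operad :: ('k::field, (nat, 'k) dup) operad) dup_operad"
proof -
  have "dup.subspace {\<mu> \<in> operations (dup_operad :: ('k, (nat, 'k) dup) operad) n. dup_delta \<mu> = 0}"
    for n
    unfolding dup_operations
    by (auto intro!: dup.subspaceI dup.span_zero dup.span_add dup.span_scale
        simp: dup_delta.zero dup_delta.add dup_delta.scale)
  then have sub: "dup.subspace (operations (prim_dup_operad :: ('k, (nat, 'k) dup) operad) n)" for n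
    by (simp add: prim_dup_operad_def)
  have id: "dup_gen 0 \<in> operations (prim_dup_operad :: ('k, (nat, 'k) dup) operad) 1"
    unfolding prim_dup_operations using mag_gen_operation mag_to_dup_gen by (metis image_eqI)
  have comp: "op_comp dup_operad ks \<mu> \<nu>s
      \<in> operations (prim_dup_operad :: ('k, (nat, 'k) dup) operad) (sum_list ks)"
    if "composable (prim_dup_operad :: ('k, (nat, 'k) dup) operad) ks \<mu> \<nu>s" for ks \<mu> \<nu>s
    using that
    by (rule composable_prim_obtains)
      (simp only: prim_dup_operations mag_to_dup_comp[symmetric] mag_comp_operation imageI)
  have act: "op_act dup_operad \<mu> \<sigma> \<in> operations (prim_dup_operad :: ('k, (nat, 'k) dup) operad) n"
    if "\<mu> \<in> operations (prim_dup_operad :: ('k, (nat, 'k) dup) operad) n" "\<sigma> permutes {..<n}"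
    for n \<mu> \<sigma>
  proof -
    from that(1) obtain \<mu>' where \<mu>': "\<mu>' \<in> operations mag_operad n" "\<mu> = mag_to_dup \<mu>'"
      unfolding prim_dup_operations by auto
    have "mag_to_dup (op_act mag_operad \<mu>' \<sigma>) \<in> mag_to_dup ` operations mag_operad n"
      by (intro imageI mag_act_operation \<mu>' that)
    then show ?thesis by (simp only: prim_dup_operations mag_to_dup_act \<mu>')
  qed
  have "prim_dup_operad = (dup_operad :: ('k, (nat, 'k) dup) operad)
      \<lparr>operations := operations prim_dup_operad\<rparr>"
    and "operations (prim_dup_operad :: ('k, (nat, 'k) dup) operad) n \<subseteq> operations dup_operad n" for n
    by (auto simp: prim_dup_operad_def)
  then show ?thesis
    unfolding suboperad_def dup_operad_simps(1,2) using sub id comp act by blast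
qed

lemma operad_iso_mag_to_dup:
  "operad_iso mag_operad (prim_dup_operad :: ('k::field, (nat, 'k) dup) operad) (\<lambda>_. mag_to_dup)"
proof -
  have "map2 (\<lambda>_. mag_to_dup) ks \<nu>s = map mag_to_dup \<nu>s"
    if "composable mag_operad ks \<mu> \<nu>s" for ks \<mu> and \<nu>s :: "(nat, 'k) mag list"
    using that by (intro nth_equalityI) (auto simp: composable_def)
  then have "operad_hom mag_operad (prim_dup_operad :: ('k, (nat, 'k) dup) operad) (\<lambda>_. mag_to_dup)"
    unfolding operad_hom_def
    by (auto simp: prim_dup_operations mag_to_dup_comp mag_to_dup_act
        simp del: mag_operad_simps(3,4) dup_operad_simps(3,4))
  then show ?thesis
    unfolding operad_iso_def
    by (auto simp: prim_dup_operations intro!: inj_on_imp_bij_betw inj_on_subset[OF inj_mag_to_dup])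
qed

section \<open>Uniqueness of the isomorphism\<close>

text \<open>On monomials this is substitution of generators for generators, so renumbering inputs
  becomes a statement about trees.\<close>

primrec relabel :: "('v \<Rightarrow> 'w) \<Rightarrow> ('o, 'v) bintree \<Rightarrow> ('o, 'w) bintree" where
  "relabel f (Leaf v) = Leaf (f v)"
| "relabel f (Node b s t) = Node b (relabel f s) (relabel f t)"

lemma leaves_relabel: "leaves (relabel f t) = map f (leaves t)"
  by (induction t) simp_all

lemma relabel_cong: "(\<And>v. v \<in> set (leaves t) \<Longrightarrow> f v = h v) \<Longrightarrow> relabel f t = relabel h t"
  by (induction t) simp_all

lemma relabel_relabel [simp]: "relabel f (relabel h t) = relabel (\<lambda>v. f (h v)) t"
  by (induction t) simp_all

lemma relabel_ident [simp]: "relabel (\<lambda>v. v) t = t"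
  by (induction t) simp_all

lemma mag_ext_gen_basis:
  "mag_ext fscale mag_mult (\<lambda>i. mag_gen (h i)) (basis t) = basis (relabel h t)"
  unfolding graft.mag_ext_basis by (induction t) (simp_all add: mag_gen_def graft_basis)

lemma basis_operation: "basis t \<in> operations mag_operad n \<longleftrightarrow> t \<in> multilinear_trees n"
  by (simp add: mag_operations multilinear_trees_iff)

text \<open>Up to a permutation of the inputs, a multilinear tree is a composite of the generator with two
  smaller multilinear trees.\<close>

lemma multilinear_Node_decomp:
  fixes s t :: "(unit, nat) bintree"
  assumes "Node () s t \<in> multilinear_trees n"
  obtains k m \<sigma> where "n = k + m" "\<sigma> permutes {..<n}"
    "relabel \<sigma> s \<in> multilinear_trees k"
    "relabel (\<lambda>i. \<sigma> i - k) t \<in> multilinear_trees m"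
    "(basis (Node () s t) :: (nat, 'k::field) mag) = op_act mag_operad (op_comp mag_operad [k, m]
      (mag_mult (mag_gen 0) (mag_gen 1))
      [basis (relabel \<sigma> s), basis (relabel (\<lambda>i. \<sigma> i - k) t)]) \<sigma>"
proof -
  define l where "l = leaves s @ leaves t"
  define k where "k = length (leaves s)"
  define m where "m = length (leaves t)"
  have l: "distinct l" "set l = {..<n}"
    using assms by (simp_all add: multilinear_trees_def l_def)
  have n: "length l = n"
    using distinct_card[OF l(1)] l(2) by simp
  then have km: "n = k + m" by (simp add: l_def k_def m_def)
  \<comment> \<open>Position i goes to the label of the i-th leaf; the identity outside makes it a
    permutation in the sense of \<open>permutes\<close>.\<close>
  define \<tau> where "\<tau> i = (if i < n then l ! i else i)" for i
  have "bij_betw ((!) l) {..<n} {..<n}"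
    using l n by (intro bij_betw_nth) auto
  then have "bij_betw \<tau> {..<n} {..<n}"
    by (rule bij_betw_cong[THEN iffD1, rotated]) (simp add: \<tau>_def)
  then have \<tau>: "\<tau> permutes {..<n}"
    by (rule bij_imp_permutes) (simp add: \<tau>_def)
  have \<tau>_l: "map \<tau> [0..<n] = l"
    using n by (auto simp: \<tau>_def intro!: nth_equalityI)
  \<comment> \<open>The action of \<sigma> substitutes along its inverse, so acting by the inverse
    of \<tau> restores the labels given by \<tau>.\<close>
  define \<sigma> where "\<sigma> = inv \<tau>"
  have \<sigma>: "\<sigma> permutes {..<n}" unfolding \<sigma>_def by (rule permutes_inv) (rule \<tau>)
  have inv_\<sigma>: "inv \<sigma> = \<tau>" unfolding \<sigma>_def by (rule inv_inv_eq) (rule permutes_bij[OF \<tau>])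
  have \<sigma>\<tau>: "\<sigma> (\<tau> i) = i" and \<tau>\<sigma>: "\<tau> (\<sigma> i) = i" for i
    using permutes_inverses[OF \<tau>] by (simp_all add: \<sigma>_def)
  \<comment> \<open>The permutation numbers the leaves from left to right: those of s become an
    initial segment and those of t the block starting at k.\<close>
  have "map \<sigma> l = [0..<n]"
    unfolding \<tau>_l[symmetric] by (simp add: \<sigma>\<tau> comp_def)
  then have "map \<sigma> (leaves s) @ map \<sigma> (leaves t) = [0..<k] @ [k..<n]"
    by (simp add: l_def km upt_add_eq_append[of 0 k m])
  then have s: "map \<sigma> (leaves s) = [0..<k]" and t: "map \<sigma> (leaves t) = [k..<n]"
    by (simp_all add: append_eq_append_conv k_def)
  have "map (\<lambda>i. \<sigma> i - k) (leaves t) = map (\<lambda>i. i - k) (map \<sigma> (leaves t))" by simp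
  also have "\<dots> = [0..<m]" unfolding t km by (auto intro!: nth_equalityI)
  finally have t': "map (\<lambda>i. \<sigma> i - k) (leaves t) = [0..<m]" .
  \<comment> \<open>Subtraction on naturals is truncated; this bound lets the shift by k in the
    composite undo it.\<close>
  have ge: "k \<le> \<sigma> v" if "v \<in> set (leaves t)" for v
  proof -
    from that have "\<sigma> v \<in> set (map \<sigma> (leaves t))" by simp
    then show ?thesis unfolding t by simp
  qed
  have "relabel (\<lambda>i. \<tau> (\<sigma> i - k + k)) t = relabel (\<lambda>i. i) t"
    by (rule relabel_cong) (simp add: ge \<tau>\<sigma>)
  then have "relabel \<tau> (relabel (\<lambda>j. j + k) (relabel (\<lambda>i. \<sigma> i - k) t)) = t"
    by simp
  moreover have "relabel \<tau> (relabel (\<lambda>j. j) (relabel \<sigma> s)) = s"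
    by (simp add: \<tau>\<sigma>)
  ultimately have eq: "(basis (Node () s t) :: (nat, 'k) mag)
      = op_act mag_operad (op_comp mag_operad [k, m] (mag_mult (mag_gen 0) (mag_gen 1))
        [basis (relabel \<sigma> s), basis (relabel (\<lambda>i. \<sigma> i - k) t)]) \<sigma>"
    by (simp add: mag_hom_simps[OF graft.mag_hom_mag_ext] graft.mag_ext_gen mag_ext_gen_basis inv_\<sigma>
        graft_basis)
  show ?thesis
    by (rule that[OF km \<sigma> _ _ eq])
      (auto simp: multilinear_trees_def leaves_relabel s t')
qed

text \<open>Mag is generated by one binary operation: every multilinear tree arises from it and the
  identity by composition and permutation, and such trees span each arity.\<close>

lemma mag_operad_hom_unique:
  assumes \<Phi>: "operad_hom mag_operad Q \<Phi>" and \<Psi>: "operad_hom mag_operad Q \<Psi>"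
    and gen: "\<Phi> 2 (mag_mult (mag_gen 0) (mag_gen 1)) = \<Psi> 2 (mag_mult (mag_gen 0) (mag_gen 1))"
    and \<mu>: "\<mu> \<in> operations mag_operad n"
  shows "\<Phi> n \<mu> = \<Psi> n (\<mu> :: (nat, 'k::field) mag)"
proof -
  let ?g = "mag_mult (mag_gen 0) (mag_gen 1) :: (nat, 'k) mag"
  have g: "?g \<in> operations mag_operad 2"
    by (simp add: mag_gen_def graft_basis basis_operation multilinear_trees_def) auto
  \<comment> \<open>The factors of a decomposed tree are relabelled subtrees, so the induction must
    range over all relabellings f.\<close>
  have tree: "\<Phi> n (basis (relabel f t)) = \<Psi> n (basis (relabel f t))"
    if "relabel f t \<in> multilinear_trees n" for n and f :: "nat \<Rightarrow> nat" and t
    using that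
  proof (induction t arbitrary: f n)
    \<comment> \<open>A multilinear leaf is the identity operation: its arity is 1 and its label
      0.\<close>
    case (Leaf v)
    then have "{f v} = {..<n}" by (simp add: multilinear_trees_def)
    then have "n = 1"
      using card_lessThan[of n] by (metis card.insert card.empty empty_iff finite.emptyI One_nat_def)
    moreover from this \<open>{f v} = _\<close> have "f v = 0" by auto
    ultimately show ?case
      using \<Phi> \<Psi> by (simp add: operad_hom_def flip: mag_gen_def)
  next
    case (Node b s t)
    then have "Node () (relabel f s) (relabel f t) \<in> multilinear_trees n" by simp
    then show ?case
    proof (rule multilinear_Node_decomp[where 'k = 'k])
      fix k m \<sigma>
      let ?s = "basis (relabel \<sigma> (relabel f s)) :: (nat, 'k) mag"
      let ?t = "basis (relabel (\<lambda>i. \<sigma> i - k) (relabel f t)) :: (nat, 'k) mag"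
      assume n: "n = k + m" and \<sigma>: "\<sigma> permutes {..<n}"
        and s: "relabel \<sigma> (relabel f s) \<in> multilinear_trees k"
        and t: "relabel (\<lambda>i. \<sigma> i - k) (relabel f t) \<in> multilinear_trees m"
        and eq: "basis (Node () (relabel f s) (relabel f t))
          = op_act mag_operad (op_comp mag_operad [k, m] ?g [?s, ?t]) \<sigma>"
      have comp: "composable mag_operad [k, m] ?g [?s, ?t]"
        using g s t by (auto simp: composable_def basis_operation less_Suc_eq numeral_2_eq_2)
      from mag_comp_operation[OF this]
      have op: "op_comp mag_operad [k, m] ?g [?s, ?t] \<in> operations mag_operad n"
        by (simp only: n) simp
      \<comment> \<open>Any morphism is determined on this tree by its value on the generator and on
        two smaller trees.\<close>
      have hom: "\<Theta> n (basis (Node () (relabel f s) (relabel f t)))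
          = op_act Q (op_comp Q [k, m] (\<Theta> 2 ?g) [\<Theta> k ?s, \<Theta> m ?t]) \<sigma>"
        if "operad_hom mag_operad Q \<Theta>" for \<Theta>
      proof -
        from that op \<sigma> have "\<Theta> n (op_act mag_operad (op_comp mag_operad [k, m] ?g [?s, ?t]) \<sigma>)
            = op_act Q (\<Theta> n (op_comp mag_operad [k, m] ?g [?s, ?t])) \<sigma>"
          unfolding operad_hom_def by blast
        also from that comp have "\<Theta> (sum_list [k, m]) (op_comp mag_operad [k, m] ?g [?s, ?t])
            = op_comp Q [k, m] (\<Theta> (length [k, m]) ?g) (map2 \<Theta> [k, m] [?s, ?t])"
          unfolding operad_hom_def by blast
        then have "\<Theta> n (op_comp mag_operad [k, m] ?g [?s, ?t])
            = op_comp Q [k, m] (\<Theta> 2 ?g) [\<Theta> k ?s, \<Theta> m ?t]"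
          by (simp add: n numeral_2_eq_2 del: mag_operad_simps)
        finally show ?thesis by (simp only: eq)
      qed
      have "\<Phi> k ?s = \<Psi> k ?s"
        using Node.IH(1)[of "\<lambda>i. \<sigma> (f i)" k] s by simp
      moreover have "\<Phi> m ?t = \<Psi> m ?t"
        using Node.IH(2)[of "\<lambda>i. \<sigma> (f i) - k" m] t by simp
      ultimately show ?thesis
        using hom[OF \<Phi>] hom[OF \<Psi>] gen by simp
    qed
  qed
  have ops: "operations mag_operad n = fvs.span (basis ` multilinear_trees n :: (nat, 'k) mag set)"
    by (simp add: mag_operad_def subst_operad_def)
  have zero: "\<Theta> n 0 = 0" if "operad_hom mag_operad Q \<Theta>" for \<Theta>
  proof -
    have "(0 :: (nat, 'k) mag) \<in> operations mag_operad n" by (simp add: ops fvs.span_zero)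
    with that have "\<Theta> n (0 + 0) = \<Theta> n 0 + \<Theta> n 0" unfolding operad_hom_def by blast
    then show ?thesis by simp
  qed
  \<comment> \<open>Membership is carried along because morphisms are additive only on elements of
    the arity component.\<close>
  from \<mu> have "\<mu> \<in> operations mag_operad n \<and> \<Phi> n \<mu> = \<Psi> n \<mu>"
    unfolding ops
  proof (induction rule: fvs.span_induct_alt)
    case base
    show ?case by (simp add: zero \<Phi> \<Psi> fvs.span_zero)
  next
    case (step c x y)
    then obtain t where t: "x = basis t" "t \<in> multilinear_trees n" by auto
    have x: "x \<in> operations mag_operad n" using t by (simp add: basis_operation)
    have y: "y \<in> operations mag_operad n" using step unfolding ops by simp
    have cx: "fscale c x \<in> operations mag_operad n"
      using x unfolding ops by (rule fvs.span_scale)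
    have lin: "\<Theta> n (fscale c x + y) = op_scale Q c (\<Theta> n x) + \<Theta> n y"
      if "operad_hom mag_operad Q \<Theta>" for \<Theta>
      using that x y cx unfolding operad_hom_def by (metis mag_operad_simps(1))
    have "\<Phi> n x = \<Psi> n x"
      using tree[of "\<lambda>v. v" t n] t by simp
    moreover have "fscale c x + y \<in> operations mag_operad n"
      using cx y unfolding ops by (rule fvs.span_add)
    ultimately show ?case using step by (simp add: lin \<Phi> \<Psi> ops)
  qed
  then show ?thesis by simp
qed

theorem theorem5p2p5:
  "suboperad (prim_dup_operad :: ('k::field, (nat, 'k) dup) operad) dup_operad \<and>
   (\<exists>\<Phi>. operad_iso mag_operad (prim_dup_operad :: ('k, (nat, 'k) dup) operad) \<Phi> \<and>
      \<Phi> 2 (mag_mult (mag_gen 0) (mag_gen 1)) =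
        dup_prec (dup_gen 0) (dup_gen 1) - dup_succ (dup_gen 0) (dup_gen 1)) \<and>
   (\<forall>\<Phi>. operad_iso mag_operad (prim_dup_operad :: ('k, (nat, 'k) dup) operad) \<Phi> \<and>
      \<Phi> 2 (mag_mult (mag_gen 0) (mag_gen 1)) =
        dup_prec (dup_gen 0) (dup_gen 1) - dup_succ (dup_gen 0) (dup_gen 1) \<longrightarrow>
      (\<forall>(scale :: 'k \<Rightarrow> 'a::ab_group_add \<Rightarrow> 'a) prec succ. dup_algebra scale prec succ \<longrightarrow>
        mag_algebra scale (\<lambda>x y. prec x y - succ x y) \<and>
        (\<forall>n. \<forall>\<mu>\<in>operations mag_operad n. \<forall>xs. length xs = n \<longrightarrow>
          dup_action scale prec succ (\<Phi> n \<mu>) xs =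
            mag_action scale (\<lambda>x y. prec x y - succ x y) \<mu> xs))) \<and>
   (\<forall>(scale :: 'k \<Rightarrow> 'a \<Rightarrow> 'a) prec succ (scale' :: 'k \<Rightarrow> 'b::ab_group_add \<Rightarrow> 'b) prec' succ' h.
      dup_algebra scale prec succ \<and> dup_algebra scale' prec' succ' \<and>
      dup_hom scale prec succ scale' prec' succ' h \<longrightarrow>
      mag_hom scale (\<lambda>x y. prec x y - succ x y) scale' (\<lambda>x y. prec' x y - succ' x y) h)"
proof (intro conjI allI impI)
  show "suboperad (prim_dup_operad :: ('k, (nat, 'k) dup) operad) dup_operad"
    by (rule suboperad_prim_dup)
  have gen: "mag_to_dup (mag_mult (mag_gen 0) (mag_gen 1))
      = (dup_prec (dup_gen 0) (dup_gen 1) - dup_succ (dup_gen 0) (dup_gen 1) :: (nat, 'k) dup)"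
    by (simp add: dup.dot_def)
  show "\<exists>\<Phi>. operad_iso mag_operad (prim_dup_operad :: ('k, (nat, 'k) dup) operad) \<Phi> \<and>
      \<Phi> 2 (mag_mult (mag_gen 0) (mag_gen 1)) =
        dup_prec (dup_gen 0) (dup_gen 1) - dup_succ (dup_gen 0) (dup_gen 1)"
    using operad_iso_mag_to_dup gen by (intro exI[of _ "\<lambda>_. mag_to_dup"]) simp
  fix \<Phi> and scale :: "'k \<Rightarrow> 'a \<Rightarrow> 'a" and prec succ
  assume \<Phi>: "operad_iso mag_operad (prim_dup_operad :: ('k, (nat, 'k) dup) operad) \<Phi> \<and>
      \<Phi> 2 (mag_mult (mag_gen 0) (mag_gen 1)) =
        dup_prec (dup_gen 0) (dup_gen 1) - dup_succ (dup_gen 0) (dup_gen 1)"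
    and "dup_algebra scale prec succ"
  then interpret dup_algebra scale prec succ by simp
  have dot: "(\<lambda>x y. prec x y - succ x y) = dot"
    by (simp add: fun_eq_iff dot_def)
  show "mag_algebra scale (\<lambda>x y. prec x y - succ x y)"
    unfolding dot by (rule mag_algebra_dot)
  show "\<forall>\<mu>\<in>operations mag_operad n. \<forall>xs. length xs = n \<longrightarrow>
      dup_action scale prec succ (\<Phi> n \<mu>) xs =
        mag_action scale (\<lambda>x y. prec x y - succ x y) \<mu> xs" for n
  proof (intro ballI allI impI)
    fix \<mu> :: "(nat, 'k) mag" and xs :: "'a list"
    assume "\<mu> \<in> operations mag_operad n"
    \<comment> \<open>The prescribed value on the generator identifies an arbitrary isomorphism with
      the constructed one, for which the actions are already compared.\<close>
    then have "\<Phi> n \<mu> = mag_to_dup \<mu>"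
      by (rule mag_operad_hom_unique[where \<Psi> = "\<lambda>_. mag_to_dup" and Q = prim_dup_operad, rotated 3])
        (use \<Phi> operad_iso_mag_to_dup gen in \<open>auto simp only: operad_iso_def\<close>)
    then show "dup_action scale prec succ (\<Phi> n \<mu>) xs =
        mag_action scale (\<lambda>x y. prec x y - succ x y) \<mu> xs"
      unfolding dot by (simp only: dup_action_def mag_action_def dup_ext_mag_to_dup)
  qed
next
  fix scale :: "'k \<Rightarrow> 'a \<Rightarrow> 'a" and prec succ and scale' :: "'k \<Rightarrow> 'b \<Rightarrow> 'b" and prec' succ' h
  assume *: "dup_algebra scale prec succ \<and> dup_algebra scale' prec' succ' \<and>
      dup_hom scale prec succ scale' prec' succ' h"
  then interpret d: dup_algebra scale prec succ by simp
  from * interpret d': dup_algebra scale' prec' succ' by simp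
  have "(\<lambda>x y. prec x y - succ x y) = d.dot" "(\<lambda>x y. prec' x y - succ' x y) = d'.dot"
    by (simp_all add: fun_eq_iff d.dot_def d'.dot_def)
  moreover have "mag_hom scale d.dot scale' d'.dot h"
    using * by (intro dup_hom_imp_mag_hom_dot) simp_all
  ultimately show "mag_hom scale (\<lambda>x y. prec x y - succ x y) scale' (\<lambda>x y. prec' x y - succ' x y) h"
    by (simp only:)
qed

end
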